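(* Consider independent observations $Y_1,\ldots,Y_n$, where $Y_i$ has density $f_{\theta_i}(y)=\exp\{(y\theta_i-b(\theta_i))/a+c(y,a)\}$ with natural parameter $\theta_i\in\Theta$, $i=1,\ldots,n$ (no assumption that $\boldsymbol{\theta}=(\theta_1,\ldots,\theta_n)^t$ equals $X\boldsymbol{\beta}$ for some $\boldsymbol{\beta}$), and suppose Assumption (A) holds. Let $X$ be a deterministic $n\times p$ design matrix of rank $r$ such that any $r$ columns of $X$ are linearly independent. Let $L_k>0$, $k=1,\ldots,r$, be weights such that $$\sum_{k=1}^{r-1}\binom{p}{k}e^{-kL_k}+e^{-rL_r}\le S$$ for some absolute constant $S$ not depending on $r,p,n$. Let the penalty satisfy $$Pen(k)\ge 2\,\frac{\mathcal{U}}{\mathcal{L}}\,k\,(A+2\sqrt{2L_k}+4L_k),\qquad k=1,\ldots,r,$$ for some $A>1$. Let $\widehat M$ be the model selected by $$\widehat M=\arg\min_{M\in\mathfrak{M}}\Big\{\tfrac{1}{a}\big(b(X\widehat{\boldsymbol{\beta}}_M)^t\mathbf{1}-\mathbf{Y}^tX\widehat{\boldsymbol{\beta}}_M\big)+Pen(|M|)\Big\},$$ where $\widehat{\boldsymbol{\beta}}_M$ is the restricted MLE defined in the context. Then $$\mathbb{E}\,KL(\boldsymbol{\theta},X\widehat{\boldsymbol{\beta}}_{\widehat M})\le\frac{4}{3}\inf_{M\in\mathfrak{M}}\Big\{\inf_{\widetilde{\boldsymbol{\beta}}\in\mathcal{B}_M}KL(\boldsymbol{\theta},X\widetilde{\boldsymbol{\beta}})+Pen(|M|)\Big\}+\frac{16}{3}\,\frac{\mathcal{U}}{\mathcal{L}}\,\frac{2A-1}{A-1}\,S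 .$$
   Context: Assumption (A): (1) $\Theta\subseteq\mathbb{R}$ is a closed (finite or infinite) interval; (2) $b$ is twice differentiable and there exist constants $0<\mathcal{L}\le\mathcal{U}<\infty$ with $\sup_{t\in\mathbb{R}}b''(t)\le\mathcal{U}$ and $\inf_{t\in\Theta}b''(t)\ge\mathcal{L}$. The scaling parameter $a>0$ is known. For vectors, $b(\boldsymbol{\theta})=(b(\theta_1),\ldots,b(\theta_n))^t$ and $b'$ is applied coordinatewise. KL divergence between the joint laws with parameters $\boldsymbol{\theta},\boldsymbol{\zeta}\in\mathbb{R}^n$: $KL(\boldsymbol{\theta},\boldsymbol{\zeta})=\frac1a\big(b'(\boldsymbol{\theta})^t(\boldsymbol{\theta}-\boldsymbol{\zeta})-(b(\boldsymbol{\theta})-b(\boldsymbol{\zeta}))^t\mathbf{1}\big)$. A model is a subset $M\subseteq\{1,\ldots,p\}$; $\mathfrak{M}$ is the collection of models of size $|M|\le r$. For a model $M$, $\mathcal{B}_M=\{\boldsymbol{\beta}\in\mathbb{R}^p:\beta_j=0\text{ for }j\notin M,\ \boldsymbol{\beta}^t\mathbf{x}_i\in\Theta\text{ for all }i\}$, where $\mathbf{x}_i^t$ is the $i$-th row of $X$, and $\widehat{\boldsymbol{\beta}}_M=\arg\max_{\widetilde{\boldsymbol{\beta}}\in\mathcal{B}_M}\{\mathbf{Y}^tX\widetilde{\boldsymbol{\beta}}-b(X\widetilde{\boldsymbol{\beta}})^t\mathbf{1}\}$ (assumed to exist). $Pen$ is a nonnegative function of the model size. The expectation is under the true distribution with parameter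 $\boldsymbol{\theta}$. *)

theory Defs
  imports "HOL-Probability.Probability"
begin

definition expfam_dens :: "real \<Rightarrow> (real \<Rightarrow> real) \<Rightarrow> (real \<Rightarrow> real \<Rightarrow> real) \<Rightarrow> real \<Rightarrow> real \<Rightarrow> real" where
  "expfam_dens a b c eta y = exp ((y * eta - b eta) / a + c y a)"

text \<open>KL divergence between the joint laws with natural parameters theta and zeta.\<close>
definition KL :: "real \<Rightarrow> (real \<Rightarrow> real) \<Rightarrow> (real \<Rightarrow> real) \<Rightarrow> real^'n \<Rightarrow> real^'n \<Rightarrow> real" where
  "KL a b b' theta zeta =
     (1 / a) * ((\<Sum>i\<in>UNIV. b' (theta $ i) * (theta $ i - zeta $ i))
               - (\<Sum>i\<in>UNIV. b (theta $ i) - b (zeta $ i)))"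

definition Bset :: "real^'p^'n \<Rightarrow> real set \<Rightarrow> 'p set \<Rightarrow> (real^'p) set" where
  "Bset X \<Theta> M = {beta. (\<forall>j. j \<notin> M \<longrightarrow> beta $ j = 0) \<and> (\<forall>i. (X *v beta) $ i \<in> \<Theta>)}"

definition loglik :: "(real \<Rightarrow> real) \<Rightarrow> real^'p^'n \<Rightarrow> real^'n \<Rightarrow> real^'p \<Rightarrow> real" where
  "loglik b X y beta = y \<bullet> (X *v beta) - (\<Sum>i\<in>UNIV. b ((X *v beta) $ i))"

definition models :: "nat \<Rightarrow> 'p set set" where
  "models r = {M. card M \<le> r}"

end

theory Submission
  imports Defs
begin

text \<open>
  The noise \<open>\<epsilon> = Y - b' \<theta>\<close> is sub-Gaussian with variance proxy \<open>a \<UU>\<close>, because the densities are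
  normalised for all natural parameters and \<open>b'' \<le> \<UU>\<close>. Minimality of the penalised criterion gives
  \<open>KL \<theta> (X \<beta>') + Pen M' \<le> KL \<theta> (X \<beta>) + Pen M + \<epsilon> \<bullet> (X \<beta>' - \<theta>) / a + \<epsilon> \<bullet> (\<theta> - X \<beta>) / a\<close> for the selected
  model \<open>M'\<close> with estimator \<open>\<beta>'\<close>; the last term has mean zero, and a quarter of \<open>KL \<theta> (X \<beta>')\<close> dominates
  \<open>\<LL> / (8 a) * norm (X \<beta>' - \<theta>)\<^sup>2\<close>. For a fixed nonempty model this leaves the squared norm of the projection
  of \<open>\<epsilon>\<close> on the column space, whose exponential moments are those of a chi-square variable with
  \<open>card M\<close> degrees of freedom; the component of \<open>\<theta>\<close> orthogonal to the column space only helps.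
  The empty model has no weight in \<open>S\<close>. Its contribution is dominated by a parabola in \<open>\<epsilon> \<bullet> \<theta>\<close> of
  nonpositive mean, at the price of a surplus \<open>2 \<UU> / \<LL>\<close> on the nonempty models, which the exponential
  moment bound absorbs. Since \<open>Mhat\<close> and the estimators may be non-measurable, the loss is bounded
  pointwise by an integrable function of \<open>Y\<close> before taking expectations.
\<close>

section \<open>Taylor's formula and Gaussian integrals\<close>

text \<open>Lagrange form, since continuity of the second derivative of \<open>b\<close> is not at
  hand. The closed segment covers both orders of \<open>x\<close> and \<open>y\<close>.\<close>

lemma second_order_Taylor:
  fixes f f1 f2 :: "real \<Rightarrow> real"
  assumes f1: "\<And>t. (f has_real_derivative f1 t) (at t)"
    and f2: "\<And>t. (f1 has_real_derivative f2 t) (at t)"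
  obtains t where "t \<in> closed_segment x y"
    and "f y = f x + f1 x * (y - x) + f2 t * (y - x)\<^sup>2 / 2"
proof (cases "x = y")
  case True
  then show ?thesis using that[of x] by simp
next
  case False
  define d where "d = (\<lambda>m::nat. if m = 0 then f else if m = 1 then f1 else f2)"
  have "\<exists>t. (if y < x then y < t \<and> t < x else x < t \<and> t < y) \<and>
      f y = (\<Sum>m<2. d m x / fact m * (y - x) ^ m) + d 2 t / fact 2 * (y - x) ^ 2"
    using False by (intro Taylor[where a = "min x y" and b = "max x y"])
      (auto simp: d_def less_2_cases_iff f1 f2)
  then obtain t where t: "if y < x then y < t \<and> t < x else x < t \<and> t < y"
      "f y = (\<Sum>m<2. d m x / fact m * (y - x) ^ m) + d 2 t / fact 2 * (y - x) ^ 2"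
    by blast
  show ?thesis
  proof (rule that[of t])
    show "t \<in> closed_segment x y"
      using t(1) by (auto simp: closed_segment_eq_real_ivl split: if_splits)
    show "f y = f x + f1 x * (y - x) + f2 t * (y - x)\<^sup>2 / 2"
      using t(2) by (simp add: d_def numeral_2_eq_2)
  qed
qed

text \<open>Completing the square: the tilted density is a constant times the normal density with
  mean \<open>c\<close>.\<close>

lemma nn_integral_exp_linear_std_normal:
  "(\<integral>\<^sup>+x. ennreal (exp (c * x) * std_normal_density x) \<partial>lborel) = ennreal (exp (c\<^sup>2 / 2))"
proof -
  have *: "exp (c * x) * std_normal_density x = exp (c\<^sup>2 / 2) * normal_density c 1 x" for x
  proof -
    have "exp (c * x) * exp (- x\<^sup>2 / 2) = exp (c\<^sup>2 / 2) * exp (- (x - c)\<^sup>2 / 2)"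
      unfolding exp_add[symmetric] by (simp add: power2_eq_square field_simps)
    then show ?thesis by (simp add: normal_density_def field_simps)
  qed
  have "(\<integral>\<^sup>+x. ennreal (normal_density c 1 x) \<partial>lborel) = 1"
    by (subst nn_integral_eq_integral) (auto simp: integrable_normal_density integral_normal_density)
  then show ?thesis
    unfolding * by (simp add: ennreal_mult nn_integral_cmult)
qed

text \<open>The integrand is \<open>s\<close> times the centred normal density with standard
  deviation \<open>s = 1 / sqrt (1 - 2 * \<alpha>)\<close>.\<close>

lemma nn_integral_exp_square_std_normal:
  assumes "2 * \<alpha> < 1"
  shows "(\<integral>\<^sup>+x. ennreal (exp (\<alpha> * x\<^sup>2) * std_normal_density x) \<partial>lborel)
           = ennreal (1 / sqrt (1 - 2 * \<alpha>))"
proof -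
  define s where "s = 1 / sqrt (1 - 2 * \<alpha>)"
  have s: "s > 0" "s\<^sup>2 = 1 / (1 - 2 * \<alpha>)"
    using assms by (auto simp: s_def power_divide)
  have *: "exp (\<alpha> * x\<^sup>2) * std_normal_density x = s * normal_density 0 s x" for x
  proof -
    have "exp (\<alpha> * x\<^sup>2) * exp (- x\<^sup>2 / 2) = exp (- x\<^sup>2 / (2 * s\<^sup>2))"
      unfolding exp_add[symmetric] s(2) using assms by (simp add: field_simps)
    then show ?thesis
      using s(1) by (simp add: normal_density_def field_simps real_sqrt_mult)
  qed
  have "(\<integral>\<^sup>+x. ennreal (normal_density 0 s x) \<partial>lborel) = 1"
    using s(1)
    by (subst nn_integral_eq_integral) (auto simp: integrable_normal_density integral_normal_density)
  then show ?thesis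
    unfolding * s_def[symmetric] using s(1) by (simp add: ennreal_mult nn_integral_cmult)
qed

section \<open>Sub-Gaussian vectors and their quadratic exponential moments\<close>

text \<open>The nonnegative integral makes finiteness of the exponential moments part of the
  inequality. Centring is a consequence on probability spaces, see
  \<open>subgaussian_linear\<close>.\<close>

definition subgaussian :: "'w measure \<Rightarrow> real \<Rightarrow> ('w \<Rightarrow> 'a::euclidean_space) \<Rightarrow> bool" where
  "subgaussian P \<tau> \<epsilon> \<longleftrightarrow> \<epsilon> \<in> borel_measurable P \<and>
     (\<forall>w. (\<integral>\<^sup>+\<omega>. ennreal (exp (w \<bullet> \<epsilon> \<omega>)) \<partial>P) \<le> ennreal (exp (\<tau> * (w \<bullet> w) / 2)))"

text \<open>The factor is that of a chi-square variable with \<open>card B\<close> degrees of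
  freedom. The linear part \<open>w\<close> changes at each induction step; later it also carries
  the component of \<theta> orthogonal to a model.\<close>

lemma subgaussian_quadratic_mgf:
  fixes \<epsilon> :: "'w \<Rightarrow> 'a::euclidean_space"
  assumes sg: "subgaussian P \<tau> \<epsilon>" and sf: "sigma_finite_measure P" and \<mu>: "\<mu> \<ge> 0" "2 * (\<mu> * \<tau>) < 1"
    and "finite B" and "pairwise orthogonal B" and "\<And>u. u \<in> B \<Longrightarrow> norm u = 1"
    and "\<And>u. u \<in> B \<Longrightarrow> w \<bullet> u = 0"
  shows "(\<integral>\<^sup>+\<omega>. ennreal (exp (\<mu> * (\<Sum>u\<in>B. (\<epsilon> \<omega> \<bullet> u)\<^sup>2) + w \<bullet> \<epsilon> \<omega>)) \<partial>P)
           \<le> ennreal ((1 / sqrt (1 - 2 * (\<mu> * \<tau>))) ^ card B * exp (\<tau> * (w \<bullet> w) / 2))"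
  using assms(5-)
proof (induction B arbitrary: w rule: finite_induct)
  case empty
  then show ?case using sg by (simp add: subgaussian_def)
next
  case (insert u B)
  have [measurable]: "\<epsilon> \<in> borel_measurable P" using sg by (simp add: subgaussian_def)
  interpret pair_sigma_finite P lborel
    by (simp add: pair_sigma_finite_def sf lborel.sigma_finite_measure_axioms)
  \<comment> \<open>Chosen so that \<open>(s * x)\<^sup>2 / 2 = \<mu> * x\<^sup>2\<close>.\<close>
  define s where "s = sqrt (2 * \<mu>)"
  have s2: "s\<^sup>2 = 2 * \<mu>" using \<mu> by (simp add: s_def)
  define q where "q = 1 / sqrt (1 - 2 * (\<mu> * \<tau>))"
  define F where "F = (\<lambda>g \<omega>. exp (\<mu> * (\<Sum>u\<in>B. (\<epsilon> \<omega> \<bullet> u)\<^sup>2) + (w + (s * g) *\<^sub>R u) \<bullet> \<epsilon> \<omega>))"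
  have F: "F g \<omega> = exp (\<mu> * (\<Sum>u\<in>B. (\<epsilon> \<omega> \<bullet> u)\<^sup>2) + w \<bullet> \<epsilon> \<omega>) * exp ((s * (\<epsilon> \<omega> \<bullet> u)) * g)" for g \<omega>
    by (simp add: F_def inner_add_left exp_add[symmetric] inner_commute algebra_simps)
  have uu: "u \<bullet> u = 1" and wu: "w \<bullet> u = 0"
    using insert.prems by (auto simp: norm_eq_1)
  have orth: "u \<bullet> v = 0" if "v \<in> B" for v
  proof -
    have "u \<noteq> v" using that insert.hyps by auto
    then show ?thesis using insert.prems(1) that by (auto simp: pairwise_def orthogonal_def)
  qed
  have ww: "(w + (s * g) *\<^sub>R u) \<bullet> (w + (s * g) *\<^sub>R u) = w \<bullet> w + 2 * \<mu> * g\<^sup>2" for g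
    using uu wu s2 by (simp add: inner_add_left inner_add_right inner_commute[of u w] power2_eq_square algebra_simps)
  text \<open>The Gaussian linearisation \<open>exp (x\<^sup>2 / 2) = \<integral> exp (x g) d\<gamma>(g)\<close> trades one square
    for a shift of the linear part \<open>w\<close> in the orthogonal direction \<open>u\<close>.\<close>
  have "(\<integral>\<^sup>+\<omega>. ennreal (exp (\<mu> * (\<Sum>u\<in>insert u B. (\<epsilon> \<omega> \<bullet> u)\<^sup>2) + w \<bullet> \<epsilon> \<omega>)) \<partial>P)
      = (\<integral>\<^sup>+\<omega>. \<integral>\<^sup>+g. ennreal (F g \<omega> * std_normal_density g) \<partial>lborel \<partial>P)"
  proof (intro nn_integral_cong)
    fix \<omega>
    let ?E = "exp (\<mu> * (\<Sum>u\<in>B. (\<epsilon> \<omega> \<bullet> u)\<^sup>2) + w \<bullet> \<epsilon> \<omega>)"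
    have "(\<integral>\<^sup>+g. ennreal (F g \<omega> * std_normal_density g) \<partial>lborel)
        = (\<integral>\<^sup>+g. ennreal ?E * ennreal (exp ((s * (\<epsilon> \<omega> \<bullet> u)) * g) * std_normal_density g) \<partial>lborel)"
      by (intro nn_integral_cong) (simp add: F ennreal_mult[symmetric] mult.assoc)
    also have "\<dots> = ennreal ?E * ennreal (exp ((s * (\<epsilon> \<omega> \<bullet> u))\<^sup>2 / 2))"
      by (subst nn_integral_cmult) (auto simp: nn_integral_exp_linear_std_normal)
    also have "\<dots> = ennreal (exp (\<mu> * (\<Sum>u\<in>insert u B. (\<epsilon> \<omega> \<bullet> u)\<^sup>2) + w \<bullet> \<epsilon> \<omega>))"
      using insert.hyps s2
      by (simp add: ennreal_mult[symmetric] exp_add[symmetric] power_mult_distrib algebra_simps)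
    finally show "ennreal (exp (\<mu> * (\<Sum>u\<in>insert u B. (\<epsilon> \<omega> \<bullet> u)\<^sup>2) + w \<bullet> \<epsilon> \<omega>))
        = (\<integral>\<^sup>+g. ennreal (F g \<omega> * std_normal_density g) \<partial>lborel)" by simp
  qed
  also have "\<dots> = (\<integral>\<^sup>+g. \<integral>\<^sup>+\<omega>. ennreal (F g \<omega> * std_normal_density g) \<partial>P \<partial>lborel)"
    by (subst Fubini') (auto simp: F_def split_def)
  \<comment> \<open>The shifted \<open>w\<close> stays orthogonal to \<open>B\<close>, so the
    induction hypothesis applies. By \<open>ww\<close> the shift adds
    \<open>2 * \<mu> * g\<^sup>2\<close> to the squared norm, and integrating over \<open>g\<close>
    yields one more factor \<open>q\<close>.\<close>
  also have "\<dots> \<le> (\<integral>\<^sup>+g. ennreal (q ^ card B * exp (\<tau> * (w \<bullet> w) / 2))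
                         * ennreal (exp ((\<mu> * \<tau>) * g\<^sup>2) * std_normal_density g) \<partial>lborel)"
  proof (intro nn_integral_mono)
    fix g :: real
    have "(\<integral>\<^sup>+\<omega>. ennreal (F g \<omega> * std_normal_density g) \<partial>P)
        = (\<integral>\<^sup>+\<omega>. ennreal (F g \<omega>) \<partial>P) * ennreal (std_normal_density g)"
      by (simp add: F_def ennreal_mult nn_integral_multc)
    also have "\<dots> \<le> ennreal (q ^ card B * exp (\<tau> * (w \<bullet> w + 2 * \<mu> * g\<^sup>2) / 2)) * ennreal (std_normal_density g)"
      unfolding F_def q_def ww[symmetric]
      using insert.prems orth
      by (intro mult_right_mono insert.IH) (auto simp: pairwise_insert inner_add_left)
    also have "\<dots> = ennreal (q ^ card B * exp (\<tau> * (w \<bullet> w) / 2)) * ennreal (exp ((\<mu> * \<tau>) * g\<^sup>2) * std_normal_density g)"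
    proof -
      have "exp (\<tau> * (w \<bullet> w + 2 * \<mu> * g\<^sup>2) / 2) = exp (\<tau> * (w \<bullet> w) / 2) * exp ((\<mu> * \<tau>) * g\<^sup>2)"
        by (simp add: exp_add[symmetric] field_simps)
      moreover have "q \<ge> 0" using \<mu> by (simp add: q_def)
      ultimately show ?thesis by (simp add: ennreal_mult[symmetric] mult.assoc)
    qed
    finally show "(\<integral>\<^sup>+\<omega>. ennreal (F g \<omega> * std_normal_density g) \<partial>P) \<le> \<dots>" .
  qed
  also have "\<dots> = ennreal (q ^ card B * exp (\<tau> * (w \<bullet> w) / 2)) * ennreal q"
    unfolding q_def by (subst nn_integral_cmult) (auto simp: nn_integral_exp_square_std_normal[OF \<mu>(2)])
  also have "\<dots> = ennreal (q ^ card (insert u B) * exp (\<tau> * (w \<bullet> w) / 2))"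
    using insert.hyps \<mu>(2) by (simp add: q_def ennreal_mult[symmetric] mult_ac)
  finally show ?case unfolding q_def .
qed

lemma subgaussian_exp_integral:
  fixes \<epsilon> :: "'w \<Rightarrow> 'a::euclidean_space"
  assumes "subgaussian P \<tau> \<epsilon>"
  shows "integrable P (\<lambda>\<omega>. exp (w \<bullet> \<epsilon> \<omega>))"
    and "(\<integral>\<omega>. exp (w \<bullet> \<epsilon> \<omega>) \<partial>P) \<le> exp (\<tau> * (w \<bullet> w) / 2)"
proof -
  have [measurable]: "\<epsilon> \<in> borel_measurable P" using assms by (simp add: subgaussian_def)
  have le: "(\<integral>\<^sup>+\<omega>. ennreal (exp (w \<bullet> \<epsilon> \<omega>)) \<partial>P) \<le> ennreal (exp (\<tau> * (w \<bullet> w) / 2))"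
    using assms by (simp add: subgaussian_def)
  show int: "integrable P (\<lambda>\<omega>. exp (w \<bullet> \<epsilon> \<omega>))"
    using le by (intro integrableI_nonneg) (auto intro: le_less_trans)
  show "(\<integral>\<omega>. exp (w \<bullet> \<epsilon> \<omega>) \<partial>P) \<le> exp (\<tau> * (w \<bullet> w) / 2)"
    using le by (simp add: nn_integral_eq_integral[OF int])
qed

section \<open>Elementary inequalities and the first two moments\<close>

text \<open>The right side is the square of \<open>2 * sinh (x/2)\<close>, and \<open>sinh\<close>
  dominates the identity in absolute value. Both sides agree to second order at 0, so no constant is
  lost in the variance bound.\<close>

lemma square_le_exp_sum: "x\<^sup>2 \<le> exp x + exp (- x) - (2::real)"
proof -
  have sq: "(exp (x/2) - exp (- (x/2)))\<^sup>2 = exp x + exp (- x) - 2" for x :: real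
    using exp_double[of "x/2"] exp_double[of "- (x/2)"] by (simp add: power2_diff mult_exp_exp)
  have *: "2 * y \<le> exp y - exp (- y)" if "y \<ge> 0" for y :: real
  proof -
    have "(\<lambda>y. exp y - exp (- y) - 2 * y) 0 \<le> (\<lambda>y::real. exp y - exp (- y) - 2 * y) y"
    proof (rule DERIV_nonneg_imp_nondecreasing[OF that])
      fix x :: real
      have "0 \<le> exp x + exp (- x) - 2"
        unfolding sq[symmetric] by simp
      then show "\<exists>d. ((\<lambda>y. exp y - exp (- y) - 2 * y) has_real_derivative d) (at x) \<and> 0 \<le> d"
        by (intro exI[of _ "exp x + exp (- x) - 2"]) (auto intro!: derivative_eq_intros)
    qed
    then show ?thesis by simp
  qed
  have "\<bar>x\<bar> \<le> \<bar>exp (x/2) - exp (- (x/2))\<bar>"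
    using *[of "x/2"] *[of "-(x/2)"] by (cases "x \<ge> 0") auto
  then show ?thesis unfolding sq[symmetric] by (rule abs_le_square_iff[THEN iffD1])
qed

text \<open>The difference vanishes at 1 and has derivative \<open>(1 - 1 / y)\<^sup>2 / 2\<close>.
  It is applied at \<open>1 + 2 * m\<close> to the chi-square factor.\<close>

lemma ln_le_half_diff_inverse:
  fixes x :: real
  assumes "x \<ge> 1"
  shows "ln x \<le> (x - 1 / x) / 2"
proof -
  have "(\<lambda>x. (x - 1 / x) / 2 - ln x) 1 \<le> (\<lambda>x. (x - 1 / x) / 2 - ln x) x"
  proof (rule DERIV_nonneg_imp_nondecreasing[OF assms])
    fix y :: real assume y: "1 \<le> y"
    have "(1 + 1 / y\<^sup>2) / 2 - 1 / y = (1 - 1 / y)\<^sup>2 / 2"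
      using y by (simp add: power2_eq_square field_simps)
    then have "0 \<le> (1 + 1 / y\<^sup>2) / 2 - 1 / y" by (simp only:) simp
    moreover have "((\<lambda>x. (x - 1 / x) / 2 - ln x) has_real_derivative (1 + 1 / y\<^sup>2) / 2 - 1 / y) (at y)"
      using y by (auto intro!: derivative_eq_intros simp: power2_eq_square field_simps)
    ultimately show "\<exists>d. ((\<lambda>x. (x - 1 / x) / 2 - ln x) has_real_derivative d) (at y) \<and> 0 \<le> d"
      by blast
  qed
  then show ?thesis by simp
qed

text \<open>Both moments are read off from the exponential bound near 0: the first-order term gives
  the mean, the second-order term the variance.\<close>

lemma subgaussian_linear:
  fixes \<epsilon> :: "'w \<Rightarrow> 'a::euclidean_space"
  assumes sg: "subgaussian P \<tau> \<epsilon>" and "prob_space P"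
  shows "integrable P (\<lambda>\<omega>. w \<bullet> \<epsilon> \<omega>)" and "(\<integral>\<omega>. w \<bullet> \<epsilon> \<omega> \<partial>P) = 0"
    and "integrable P (\<lambda>\<omega>. (w \<bullet> \<epsilon> \<omega>)\<^sup>2)" and "(\<integral>\<omega>. (w \<bullet> \<epsilon> \<omega>)\<^sup>2 \<partial>P) \<le> \<tau> * (w \<bullet> w)"
proof -
  interpret prob_space P by fact
  have [measurable]: "\<epsilon> \<in> borel_measurable P" using sg by (simp add: subgaussian_def)
  note ei = subgaussian_exp_integral[OF sg]
  have int_s: "integrable P (\<lambda>\<omega>. exp (s * (v \<bullet> \<epsilon> \<omega>)))"
    and le_s: "(\<integral>\<omega>. exp (s * (v \<bullet> \<epsilon> \<omega>)) \<partial>P) \<le> exp (\<tau> * (v \<bullet> v) / 2 * s\<^sup>2)" for s v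
    using ei[of "s *\<^sub>R v"] by (auto simp: power2_eq_square mult_ac)
  have int2: "integrable P (\<lambda>\<omega>. (v \<bullet> \<epsilon> \<omega>)\<^sup>2)" for v
  proof (rule Bochner_Integration.integrable_bound)
    show "integrable P (\<lambda>\<omega>. exp (1 * (v \<bullet> \<epsilon> \<omega>)) + exp ((-1) * (v \<bullet> \<epsilon> \<omega>)))"
      by (intro Bochner_Integration.integrable_add int_s)
    have "(v \<bullet> \<epsilon> \<omega>)\<^sup>2 \<le> exp (v \<bullet> \<epsilon> \<omega>) + exp (- (v \<bullet> \<epsilon> \<omega>))" for \<omega>
      using square_le_exp_sum[of "v \<bullet> \<epsilon> \<omega>"] by simp
    then show "AE \<omega> in P. norm ((v \<bullet> \<epsilon> \<omega>)\<^sup>2) \<le> norm (exp (1 * (v \<bullet> \<epsilon> \<omega>)) + exp ((-1) * (v \<bullet> \<epsilon> \<omega>)))"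
      by (auto simp: abs_of_pos add_pos_pos)
  qed simp
  have int1: "integrable P (\<lambda>\<omega>. v \<bullet> \<epsilon> \<omega>)" for v
    by (rule square_integrable_imp_integrable[OF _ int2]) simp
  show "integrable P (\<lambda>\<omega>. w \<bullet> \<epsilon> \<omega>)" "integrable P (\<lambda>\<omega>. (w \<bullet> \<epsilon> \<omega>)\<^sup>2)"
    by (rule int1 int2)+
  \<comment> \<open>Integrate \<open>1 + s * x \<le> exp (s * x)\<close>, divide by \<open>s\<close>
    and let \<open>s\<close> decrease to 0; the exponent of the bound is quadratic in
    \<open>s\<close>. Taking \<open>w\<close> and \<open>- w\<close> then forces mean zero.\<close>
  have le0: "(\<integral>\<omega>. v \<bullet> \<epsilon> \<omega> \<partial>P) \<le> 0" for v
  proof (rule tendsto_lowerbound)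
    show "((\<lambda>s. (exp (\<tau> * (v \<bullet> v) / 2 * s\<^sup>2) - 1) / s) \<longlongrightarrow> 0) (at_right 0)"
    proof (rule filterlim_mono[OF _ order_refl])
      show "at_right 0 \<le> at (0::real)" by (rule at_le) simp
      have "((\<lambda>s. exp (\<tau> * (v \<bullet> v) / 2 * s\<^sup>2)) has_real_derivative 0) (at 0)"
        by (auto intro!: derivative_eq_intros)
      from DERIV_D[OF this]
      show "((\<lambda>s. (exp (\<tau> * (v \<bullet> v) / 2 * s\<^sup>2) - 1) / s) \<longlongrightarrow> 0) (at 0)" by simp
    qed
    show "eventually (\<lambda>s. (\<integral>\<omega>. v \<bullet> \<epsilon> \<omega> \<partial>P) \<le> (exp (\<tau> * (v \<bullet> v) / 2 * s\<^sup>2) - 1) / s) (at_right 0)"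
      unfolding eventually_at_right_field
    proof (intro exI[of _ 1] conjI allI impI)
      fix s :: real assume s: "0 < s"
      have "1 + s * (\<integral>\<omega>. v \<bullet> \<epsilon> \<omega> \<partial>P) = (\<integral>\<omega>. 1 + s * (v \<bullet> \<epsilon> \<omega>) \<partial>P)"
        using int1 by (simp add: prob_space)
      also have "\<dots> \<le> (\<integral>\<omega>. exp (s * (v \<bullet> \<epsilon> \<omega>)) \<partial>P)"
        using int1 int_s by (intro integral_mono) (auto simp: exp_ge_add_one_self)
      also note le_s
      finally show "(\<integral>\<omega>. v \<bullet> \<epsilon> \<omega> \<partial>P) \<le> (exp (\<tau> * (v \<bullet> v) / 2 * s\<^sup>2) - 1) / s"
        using s by (simp add: field_simps)
    qed simp
  qed simp
  show "(\<integral>\<omega>. w \<bullet> \<epsilon> \<omega> \<partial>P) = 0"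
    using le0[of w] le0[of "- w"] by simp
  define \<kappa> where "\<kappa> = \<tau> * (w \<bullet> w) / 2"
  \<comment> \<open>Adding the exponentials at \<open>s\<close> and \<open>- s\<close> removes the
    linear term; in \<open>h = s\<^sup>2\<close> the limit is the derivative of
    \<open>2 * exp (\<kappa> * h)\<close> at 0.\<close>
  have "(\<integral>\<omega>. (w \<bullet> \<epsilon> \<omega>)\<^sup>2 \<partial>P) \<le> 2 * \<kappa>"
  proof (rule tendsto_lowerbound)
    have "((\<lambda>h. (exp (\<kappa> * h) - 1) / h) \<longlongrightarrow> \<kappa>) (at 0)"
    proof -
      have "((\<lambda>s. exp (\<kappa> * s)) has_real_derivative \<kappa>) (at 0)"
        by (auto intro!: derivative_eq_intros)
      from DERIV_D[OF this] show ?thesis by simp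
    qed
    then have "((\<lambda>h. (exp (\<kappa> * h) - 1) / h) \<longlongrightarrow> \<kappa>) (at_right 0)"
      by (rule filterlim_mono) (auto intro: at_le)
    then show "((\<lambda>h. 2 * ((exp (\<kappa> * h) - 1) / h)) \<longlongrightarrow> 2 * \<kappa>) (at_right 0)"
      by (intro tendsto_intros)
    show "eventually (\<lambda>h. (\<integral>\<omega>. (w \<bullet> \<epsilon> \<omega>)\<^sup>2 \<partial>P) \<le> 2 * ((exp (\<kappa> * h) - 1) / h)) (at_right 0)"
      unfolding eventually_at_right_field
    proof (intro exI[of _ 1] conjI allI impI)
      fix h :: real assume h: "0 < h"
      define s where "s = sqrt h"
      have s: "s\<^sup>2 = h" using h by (simp add: s_def)
      have "h * (\<integral>\<omega>. (w \<bullet> \<epsilon> \<omega>)\<^sup>2 \<partial>P) = (\<integral>\<omega>. (s * (w \<bullet> \<epsilon> \<omega>))\<^sup>2 \<partial>P)"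
        using int2 by (simp add: power_mult_distrib s)
      also have "\<dots> \<le> (\<integral>\<omega>. exp (s * (w \<bullet> \<epsilon> \<omega>)) + exp ((- s) * (w \<bullet> \<epsilon> \<omega>)) - 2 \<partial>P)"
      proof (rule integral_mono)
        show "integrable P (\<lambda>\<omega>. (s * (w \<bullet> \<epsilon> \<omega>))\<^sup>2)"
          using int2 by (simp add: power_mult_distrib)
        show "integrable P (\<lambda>\<omega>. exp (s * (w \<bullet> \<epsilon> \<omega>)) + exp ((- s) * (w \<bullet> \<epsilon> \<omega>)) - 2)"
          by (intro Bochner_Integration.integrable_diff Bochner_Integration.integrable_add int_s) simp
        show "(s * (w \<bullet> \<epsilon> \<omega>))\<^sup>2 \<le> exp (s * (w \<bullet> \<epsilon> \<omega>)) + exp ((- s) * (w \<bullet> \<epsilon> \<omega>)) - 2" for \<omega>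
          using square_le_exp_sum[of "s * (w \<bullet> \<epsilon> \<omega>)"] by simp
      qed
      also have "\<dots> = (\<integral>\<omega>. exp (s * (w \<bullet> \<epsilon> \<omega>)) \<partial>P) + (\<integral>\<omega>. exp ((- s) * (w \<bullet> \<epsilon> \<omega>)) \<partial>P) - 2"
        using int_s[of s w] int_s[of "- s" w] by (simp add: prob_space)
      also have "\<dots> \<le> 2 * (exp (\<kappa> * h) - 1)"
        using le_s[of s w] le_s[of "- s" w] by (simp add: s \<kappa>_def)
      finally show "(\<integral>\<omega>. (w \<bullet> \<epsilon> \<omega>)\<^sup>2 \<partial>P) \<le> 2 * ((exp (\<kappa> * h) - 1) / h)"
        using h by (simp add: field_simps)
    qed simp
  qed simp
  then show "(\<integral>\<omega>. (w \<bullet> \<epsilon> \<omega>)\<^sup>2 \<partial>P) \<le> \<tau> * (w \<bullet> w)" by (simp add: \<kappa>_def)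
qed

section \<open>Exponential families have sub-Gaussian noise\<close>

text \<open>Tilting by \<open>w\<close> moves the natural parameter to \<open>t + a * w\<close>,
  where the density again has mass 1. What is left is \<open>exp\<close> of the second-order
  remainder of \<open>b\<close> divided by \<open>a\<close>.\<close>

lemma expfam_mgf:
  fixes \<nu> :: "real measure"
  assumes b1: "\<And>t. (b has_real_derivative b1 t) (at t)"
    and b2: "\<And>t. (b1 has_real_derivative b2 t) (at t)"
    and b2_upper: "\<And>t. b2 t \<le> U"
    and a_pos: "a > 0"
    and nu_sets: "sets \<nu> = sets borel"
    and normalized: "\<And>eta. (\<integral>\<^sup>+ y. ennreal (expfam_dens a b c eta y) \<partial>\<nu>) = 1"
    and distr: "distributed P \<nu> Z (\<lambda>y. ennreal (expfam_dens a b c t y))"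
  shows "(\<integral>\<^sup>+\<omega>. ennreal (exp (w * (Z \<omega> - b1 t))) \<partial>P) \<le> ennreal (exp (a * U * w\<^sup>2 / 2))"
proof -
  let ?f = "expfam_dens a b c"
  note [measurable_cong] = nu_sets
  have [measurable]: "(\<lambda>y. ennreal (?f t y)) \<in> borel_measurable \<nu>"
    using distributed_borel_measurable[OF distr] .
  define s where "s = t + a * w"
  define C where "C = exp ((b s - b t) / a - w * b1 t)"
  have shift: "?f t y * exp (w * (y - b1 t)) = C * ?f s y" for y
  proof -
    have "(y * t - b t) / a + c y a + w * (y - b1 t) = ((b s - b t) / a - w * b1 t) + ((y * s - b s) / a + c y a)"
      using a_pos by (simp add: s_def field_simps)
    then show ?thesis by (simp add: expfam_dens_def C_def exp_add[symmetric])
  qed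
  have eq: "ennreal (?f t y) * ennreal (exp (w * (y - b1 t))) = ennreal C * ennreal (?f s y)" for y
    using shift[of y] by (simp add: ennreal_mult[symmetric] expfam_dens_def C_def)
  have C_le: "C \<le> exp (a * U * w\<^sup>2 / 2)"
  proof -
    obtain u where "b s = b t + b1 t * (s - t) + b2 u * (s - t)\<^sup>2 / 2"
      using second_order_Taylor[OF b1 b2, of t s] by metis
    then have u: "b s - b t = a * (w * b1 t) + b2 u * (a * w)\<^sup>2 / 2"
      by (simp add: s_def)
    have "(b s - b t) / a - w * b1 t = b2 u * (a * w\<^sup>2) / 2"
      unfolding u using a_pos by (simp add: field_simps power2_eq_square)
    also have "\<dots> \<le> U * (a * w\<^sup>2) / 2"
      using b2_upper[of u] a_pos by (intro divide_right_mono mult_right_mono) auto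
    finally show ?thesis by (simp add: C_def mult_ac)
  qed
  have "(\<integral>\<^sup>+\<omega>. ennreal (exp (w * (Z \<omega> - b1 t))) \<partial>P)
      = (\<integral>\<^sup>+y. ennreal (?f t y) * ennreal (exp (w * (y - b1 t))) \<partial>\<nu>)"
    by (rule distributed_nn_integral[OF distr, symmetric]) simp
  also have "\<dots> = (\<integral>\<^sup>+y. ennreal C * ennreal (?f s y) \<partial>\<nu>)"
    unfolding eq ..
  also have "\<dots> = ennreal C * (\<integral>\<^sup>+y. ennreal (?f s y) \<partial>\<nu>)"
  proof (rule nn_integral_cmult)
    \<comment> \<open>Measurability is known from \<open>distr\<close> at \<open>t\<close> only;
      undoing the tilt transfers it to \<open>s\<close>.\<close>
    have "ennreal (?f s y) = ennreal (1 / C) * (ennreal (?f t y) * ennreal (exp (w * (y - b1 t))))" for y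
      unfolding eq by (simp add: C_def ennreal_mult[symmetric] mult.assoc[symmetric])
    then show "(\<lambda>y. ennreal (?f s y)) \<in> borel_measurable \<nu>" by simp
  qed
  also have "\<dots> = ennreal C" by (simp add: normalized)
  also have "\<dots> \<le> ennreal (exp (a * U * w\<^sup>2 / 2))" using C_le by (rule ennreal_leI)
  finally show ?thesis .
qed

text \<open>Independence factorises the exponential moment over the coordinates.\<close>

lemma expfam_subgaussian:
  fixes \<nu> :: "real measure" and Y :: "'w \<Rightarrow> real^'n"
  assumes b1: "\<And>t. (b has_real_derivative b1 t) (at t)"
    and b2: "\<And>t. (b1 has_real_derivative b2 t) (at t)"
    and b2_upper: "\<And>t. b2 t \<le> U"
    and a_pos: "a > 0"
    and prob: "prob_space P"
    and nu_sets: "sets \<nu> = sets borel"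
    and normalized: "\<And>eta. (\<integral>\<^sup>+ y. ennreal (expfam_dens a b c eta y) \<partial>\<nu>) = 1"
    and indep: "prob_space.indep_vars P (\<lambda>_. borel) (\<lambda>i \<omega>. Y \<omega> $ i) UNIV"
    and distr: "\<And>i. distributed P \<nu> (\<lambda>\<omega>. Y \<omega> $ i) (\<lambda>y. ennreal (expfam_dens a b c (\<theta> $ i) y))"
  shows "subgaussian P (a * U) (\<lambda>\<omega>. Y \<omega> - (\<chi> i. b1 (\<theta> $ i)))"
  unfolding subgaussian_def
proof (intro conjI allI)
  interpret prob_space P by fact
  have Yi: "(\<lambda>\<omega>. Y \<omega> $ i) \<in> borel_measurable P" for i
    using indep unfolding indep_vars_def by auto
  have Y[measurable]: "Y \<in> borel_measurable P"
    unfolding borel_measurable_euclidean_space[of Y] Basis_vec_def using Yi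
    by (auto simp: inner_axis)
  then show "(\<lambda>\<omega>. Y \<omega> - (\<chi> i. b1 (\<theta> $ i))) \<in> borel_measurable P" by simp
  fix w :: "real^'n"
  have "(\<integral>\<^sup>+\<omega>. ennreal (exp (w \<bullet> (Y \<omega> - (\<chi> i. b1 (\<theta> $ i))))) \<partial>P)
      = (\<integral>\<^sup>+\<omega>. (\<Prod>i\<in>UNIV. ennreal (exp (w $ i * (Y \<omega> $ i - b1 (\<theta> $ i))))) \<partial>P)"
    by (simp add: inner_vec_def exp_sum prod_ennreal)
  also have "\<dots> = (\<Prod>i\<in>UNIV. \<integral>\<^sup>+\<omega>. ennreal (exp (w $ i * (Y \<omega> $ i - b1 (\<theta> $ i)))) \<partial>P)"
    by (intro indep_vars_nn_integral indep_vars_compose2[OF indep]) auto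
  also have "\<dots> \<le> (\<Prod>i\<in>UNIV. ennreal (exp (a * U * (w $ i)\<^sup>2 / 2)))"
    by (intro prod_mono_ennreal expfam_mgf[OF b1 b2 b2_upper a_pos nu_sets normalized distr])
  also have "\<dots> = ennreal (exp (a * U * (w \<bullet> w) / 2))"
    by (simp add: prod_ennreal exp_sum[symmetric] inner_vec_def sum_distrib_left sum_divide_distrib power2_eq_square)
  finally show "(\<integral>\<^sup>+\<omega>. ennreal (exp (w \<bullet> (Y \<omega> - (\<chi> i. b1 (\<theta> $ i))))) \<partial>P) \<le> \<dots>" .
qed

section \<open>Kullback-Leibler divergence: curvature and differences\<close>

text \<open>Each coordinate contributes the second-order remainder of \<open>b\<close> at
  \<open>\<theta> $ i\<close>. The intermediate point stays in the interval \<open>\<Theta>\<close>,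
  where \<open>b2\<close> is bounded below.\<close>

lemma KL_ge_norm_square:
  fixes \<theta> \<zeta> :: "real^'n"
  assumes I: "is_interval \<Theta>"
    and b1: "\<And>t. (b has_real_derivative b1 t) (at t)"
    and b2: "\<And>t. (b1 has_real_derivative b2 t) (at t)"
    and b2_lower: "\<And>t. t \<in> \<Theta> \<Longrightarrow> b2 t \<ge> \<LL>"
    and a_pos: "a > 0" and "\<And>i. \<theta> $ i \<in> \<Theta>" and "\<And>i. \<zeta> $ i \<in> \<Theta>"
  shows "\<LL> / (2 * a) * (norm (\<zeta> - \<theta>))\<^sup>2 \<le> KL a b b1 \<theta> \<zeta>"
proof -
  have *: "\<LL> / 2 * (\<zeta> $ i - \<theta> $ i)\<^sup>2 \<le> b1 (\<theta> $ i) * (\<theta> $ i - \<zeta> $ i) - (b (\<theta> $ i) - b (\<zeta> $ i))" for i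
  proof -
    obtain u where u: "u \<in> closed_segment (\<theta> $ i) (\<zeta> $ i)"
      "b (\<zeta> $ i) = b (\<theta> $ i) + b1 (\<theta> $ i) * (\<zeta> $ i - \<theta> $ i) + b2 u * (\<zeta> $ i - \<theta> $ i)\<^sup>2 / 2"
      using second_order_Taylor[OF b1 b2] by metis
    have "u \<in> \<Theta>"
      using u(1) closed_segment_subset[OF _ _ is_interval_convex[OF I]] assms(6,7) by blast
    then have "\<LL> * (\<zeta> $ i - \<theta> $ i)\<^sup>2 \<le> b2 u * (\<zeta> $ i - \<theta> $ i)\<^sup>2"
      by (intro mult_right_mono b2_lower) auto
    then show ?thesis using u(2) by (simp add: algebra_simps)
  qed
  have "\<LL> / (2 * a) * (norm (\<zeta> - \<theta>))\<^sup>2 = (1 / a) * (\<Sum>i\<in>UNIV. \<LL> / 2 * (\<zeta> $ i - \<theta> $ i)\<^sup>2)"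
    unfolding power2_norm_eq_inner
    by (simp add: inner_vec_def sum_distrib_left power2_eq_square mult_ac)
  also have "\<dots> \<le> (1 / a) * (\<Sum>i\<in>UNIV. b1 (\<theta> $ i) * (\<theta> $ i - \<zeta> $ i) - (b (\<theta> $ i) - b (\<zeta> $ i)))"
    using a_pos * by (intro mult_left_mono sum_mono) auto
  also have "\<dots> = KL a b b1 \<theta> \<zeta>"
    by (simp add: KL_def sum_subtractf)
  finally show ?thesis .
qed

text \<open>The terms in \<open>b (\<theta> $ i)\<close> cancel, and \<open>b1\<close> is exchanged
  for \<open>y\<close> at the price of a noise term. It is an identity in \<open>y\<close>, hence
  usable outcome by outcome.\<close>

lemma KL_diff_eq_loglik_diff:
  fixes \<theta> y :: "real^'n" and X :: "real^'p^'n"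
  shows "KL a b b1 \<theta> (X *v \<beta>) - KL a b b1 \<theta> (X *v \<gamma>)
    = (1 / a) * (loglik b X y \<gamma> - loglik b X y \<beta> + (y - (\<chi> i. b1 (\<theta> $ i))) \<bullet> (X *v \<beta> - X *v \<gamma>))"
  unfolding KL_def loglik_def inner_diff_left inner_diff_right
  unfolding inner_vec_def
  by (simp add: sum_subtractf right_diff_distrib sum.distrib diff_divide_distrib add_divide_distrib)

section \<open>Deterministic inequalities for the empty and the nonempty models\<close>

text \<open>Both lines are tangent to the parabola, at \<open>e = - w / (2 * \<kappa>)\<close> and
  \<open>e = 1 / (2 * \<kappa>)\<close>. If \<open>e\<close> is centred with variance at most
  \<open>v\<close>, the right side has nonpositive mean although it dominates a maximum.\<close>

lemma parabola_dominates_max: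
  fixes e v \<kappa> :: real
  assumes \<kappa>: "\<kappa> > 0" and v: "v \<ge> 0"
  defines "w \<equiv> 4 * \<kappa>\<^sup>2 * v"
  shows "max (- e - \<kappa> * v) (- 1 / (4 * \<kappa>)) \<le> - (1 / (1 + w)) * e + \<kappa> / (1 + w) * (e\<^sup>2 - v)"
proof -
  have w: "w \<ge> 0" using v by (simp add: w_def)
  have v_eq: "v = w / (4 * \<kappa>\<^sup>2)" using \<kappa> by (simp add: w_def)
  have 1: "- (1 / (1 + w)) * e + \<kappa> / (1 + w) * (e\<^sup>2 - v) + 1 / (4 * \<kappa>) = \<kappa> / (1 + w) * (e - 1 / (2 * \<kappa>))\<^sup>2"
    using \<kappa> w unfolding v_eq by (simp add: divide_simps) (simp add: power2_eq_square algebra_simps)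
  have 2: "- (1 / (1 + w)) * e + \<kappa> / (1 + w) * (e\<^sup>2 - v) + e + \<kappa> * v = \<kappa> / (1 + w) * (e + w / (2 * \<kappa>))\<^sup>2"
    using \<kappa> w unfolding v_eq by (simp add: divide_simps) (simp add: power2_eq_square algebra_simps)
  have "0 \<le> \<kappa> / (1 + w) * (e - 1 / (2 * \<kappa>))\<^sup>2" "0 \<le> \<kappa> / (1 + w) * (e + w / (2 * \<kappa>))\<^sup>2"
    using \<kappa> w by auto
  then show ?thesis unfolding 1[symmetric] 2[symmetric] by auto
qed

text \<open>Pythagoras splits \<open>\<zeta> - \<theta>\<close> into \<open>z\<close> in the span
  and \<open>- \<theta>'\<close> orthogonal to it. The square is completed in \<open>z\<close> only;
  the linear term in \<open>\<theta>'\<close> keeps its own negative quadratic, which later pays for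
  it in expectation.\<close>

lemma inner_minus_quadratic_le_projection:
  fixes \<epsilon> \<theta> \<zeta> :: "'a::euclidean_space"
  assumes B: "finite B" "pairwise orthogonal B" "\<And>u. u \<in> B \<Longrightarrow> norm u = 1"
    and \<zeta>: "\<zeta> \<in> span B" and L: "L > 0"
  defines "\<theta>' \<equiv> \<theta> - (\<Sum>u\<in>B. (\<theta> \<bullet> u) *\<^sub>R u)"
  shows "\<epsilon> \<bullet> (\<zeta> - \<theta>) - L / 8 * (norm (\<zeta> - \<theta>))\<^sup>2
     \<le> 2 / L * (\<Sum>u\<in>B. (\<epsilon> \<bullet> u)\<^sup>2) - \<epsilon> \<bullet> \<theta>' - L / 8 * (\<theta>' \<bullet> \<theta>')"
    and "\<And>u. u \<in> B \<Longrightarrow> \<theta>' \<bullet> u = 0"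
proof -
  define p where "p = (\<lambda>x. \<Sum>u\<in>B. (x \<bullet> u) *\<^sub>R u)"
  have uv: "u \<bullet> v = (if u = v then 1 else 0)" if "u \<in> B" "v \<in> B" for u v
    using that B(2,3) by (auto simp: pairwise_def orthogonal_def norm_eq_1)
  have pu: "p x \<bullet> u = x \<bullet> u" if "u \<in> B" for x u
  proof -
    have "p x \<bullet> u = (\<Sum>v\<in>B. if u = v then x \<bullet> u else 0)"
      unfolding p_def inner_sum_left using that by (intro sum.cong) (auto simp: uv)
    then show ?thesis using that B(1) by simp
  qed
  have orth: "(x - p x) \<bullet> z = 0" if "z \<in> span B" for x z
  proof -
    have "orthogonal (x - p x) z"
      by (rule orthogonal_to_span[OF that]) (simp add: orthogonal_def inner_diff_left pu)
    then show ?thesis by (simp add: orthogonal_def)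
  qed
  show perp: "\<theta>' \<bullet> u = 0" if "u \<in> B" for u
    using orth[of u \<theta>] that by (simp add: \<theta>'_def p_def span_base)
  have pspan: "p x \<in> span B" for x
    unfolding p_def by (intro span_sum span_scale span_base)
  define z where "z = \<zeta> - p \<theta>"
  have z: "z \<in> span B" unfolding z_def by (intro span_diff \<zeta> pspan)
  have decomp: "\<zeta> - \<theta> = z - \<theta>'" by (simp add: z_def \<theta>'_def p_def)
  have \<theta>z: "\<theta>' \<bullet> z = 0" using orth[OF z, of \<theta>] by (simp add: \<theta>'_def p_def)
  have nrm: "(norm (\<zeta> - \<theta>))\<^sup>2 = z \<bullet> z + \<theta>' \<bullet> \<theta>'"
    unfolding decomp power2_norm_eq_inner using \<theta>z
    by (simp add: inner_diff_left inner_diff_right inner_commute[of z \<theta>'])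
  have \<epsilon>z: "\<epsilon> \<bullet> z = p \<epsilon> \<bullet> z" using orth[OF z, of \<epsilon>] by (simp add: inner_diff_left)
  have pp: "p \<epsilon> \<bullet> p \<epsilon> = (\<Sum>u\<in>B. (\<epsilon> \<bullet> u)\<^sup>2)"
  proof -
    have "p \<epsilon> \<bullet> p \<epsilon> = (\<Sum>u\<in>B. (\<epsilon> \<bullet> u) * (p \<epsilon> \<bullet> u))"
      by (subst (2) p_def) (simp add: inner_sum_right)
    then show ?thesis by (simp add: pu power2_eq_square)
  qed
  \<comment> \<open>\<open>(4 / L) *\<^sub>R p \<epsilon>\<close> maximises
    \<open>p \<epsilon> \<bullet> z - L / 8 * (z \<bullet> z)\<close>.\<close>
  have "0 \<le> L / 8 * ((z - (4 / L) *\<^sub>R p \<epsilon>) \<bullet> (z - (4 / L) *\<^sub>R p \<epsilon>))"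
    using L by simp
  also have "\<dots> = L / 8 * (z \<bullet> z) - p \<epsilon> \<bullet> z + 2 / L * (p \<epsilon> \<bullet> p \<epsilon>)"
    using L by (simp add: inner_diff_left inner_diff_right inner_commute[of z "p \<epsilon>"] field_simps)
  finally show "\<epsilon> \<bullet> (\<zeta> - \<theta>) - L / 8 * (norm (\<zeta> - \<theta>))\<^sup>2
     \<le> 2 / L * (\<Sum>u\<in>B. (\<epsilon> \<bullet> u)\<^sup>2) - \<epsilon> \<bullet> \<theta>' - L / 8 * (\<theta>' \<bullet> \<theta>')"
    unfolding nrm pp[symmetric] unfolding decomp inner_diff_right \<epsilon>z by (simp add: algebra_simps add_divide_distrib)
qed

section \<open>Integrable majorants: one subspace, then all nonempty models\<close>

text \<open>The supremum over \<open>\<zeta>\<close> is at most a quadratic \<open>T\<close> in the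
  noise, and the excess of \<open>T\<close> over the penalty is dominated by an exponential with a
  chi-square type moment. \<open>H\<close> is an explicit function of the noise, so it is measurable
  however \<open>\<zeta>\<close> is picked.\<close>

lemma subspace_excess_bound:
  fixes \<epsilon> :: "'w \<Rightarrow> 'a::euclidean_space"
  assumes sg: "subgaussian P (a * U) \<epsilon>" and prob: "prob_space P"
    and a: "a > 0" and L: "0 < L" "L \<le> U" and A: "A > 1" and l: "l > 0"
    and V: "subspace V" "dim V \<le> k"
  obtains H where "integrable P H" and "\<And>\<omega>. 0 \<le> H \<omega>"
    and "\<And>\<omega> \<zeta>. \<zeta> \<in> V \<Longrightarrow> \<epsilon> \<omega> \<bullet> (\<zeta> - \<theta>) / a - L / (8 * a) * (norm (\<zeta> - \<theta>))\<^sup>2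
           - 2 * (U / L) * real k * (A + 2 * sqrt (2 * l) + 4 * l) + 2 * (U / L) \<le> H \<omega>"
    and "(\<integral>\<omega>. H \<omega> \<partial>P) \<le> 2 * (U / L) * ((2 * A - 1) / (A - 1)) * exp (- real k * l)"
proof -
  interpret prob_space P by fact
  have [measurable]: "\<epsilon> \<in> borel_measurable P" using sg by (simp add: subgaussian_def)
  have U: "U > 0" using L by simp
  obtain B where B: "pairwise orthogonal B" "\<And>u. u \<in> B \<Longrightarrow> norm u = 1"
      "independent B" "card B = dim V" "span B = V"
    using orthonormal_basis_subspace[OF V(1)] by metis
  have finB: "finite B" using B(3) by (rule independent_imp_finite)
  define \<theta>' where "\<theta>' = \<theta> - (\<Sum>u\<in>B. (\<theta> \<bullet> u) *\<^sub>R u)"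
  have proj: "x \<bullet> (\<zeta> - \<theta>) - L / 8 * (norm (\<zeta> - \<theta>))\<^sup>2
     \<le> 2 / L * (\<Sum>u\<in>B. (x \<bullet> u)\<^sup>2) - x \<bullet> \<theta>' - L / 8 * (\<theta>' \<bullet> \<theta>')" if "\<zeta> \<in> V" for x \<zeta>
    unfolding \<theta>'_def using B finB L that by (intro inner_minus_quadratic_le_projection(1)) auto
  have perp: "\<theta>' \<bullet> u = 0" if "u \<in> B" for u
    unfolding \<theta>'_def using B finB that
    by (intro inner_minus_quadratic_le_projection(2)[where \<zeta> = 0 and L = 1]) (auto simp: span_zero)
  define s where "s = sqrt (2 * l)"
  have s: "s > 0" "s\<^sup>2 = 2 * l" using l by (auto simp: s_def)
  text \<open>With this \<open>\<rho>\<close>, \<open>1 / \<rho> = 2 + 1 / m \<le> (2 A - 1) / (A - 1)\<close>, and the Laplace exponent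
    is at most \<open>- 2 k l\<close>.\<close>
  define m where "m = A - 1 + s"
  define \<rho> where "\<rho> = m / (1 + 2 * m)"
  have m: "m > 0" "m \<ge> s" "m \<ge> A - 1" using A s by (auto simp: m_def)
  have \<rho>: "\<rho> > 0" "2 * \<rho> < 1" "1 - 2 * \<rho> = 1 / (1 + 2 * m)"
    using m by (auto simp: \<rho>_def field_simps)
  define pen where "pen = real k * (A + 2 * s + 4 * l)"
  \<comment> \<open>The factor of the penalty: dividing \<open>T\<close> by it turns
    \<open>2 / L * Q \<omega> / a\<close> into \<open>Q \<omega> / (a * U)\<close>, normalised by
    the variance proxy.\<close>
  define c where "c = 2 * (U / L)"
  have c: "c > 0" using U L by (simp add: c_def)
  define Q where "Q = (\<lambda>\<omega>. \<Sum>u\<in>B. (\<epsilon> \<omega> \<bullet> u)\<^sup>2)"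
  define T where "T = (\<lambda>\<omega>. (2 / L * Q \<omega> - \<epsilon> \<omega> \<bullet> \<theta>' - L / 8 * (\<theta>' \<bullet> \<theta>')) / a)"
  define H where "H = (\<lambda>\<omega>. c / \<rho> * exp (\<rho> * (T \<omega> / c - pen)))"
  have [measurable]: "H \<in> borel_measurable P" unfolding H_def T_def Q_def by measurable
  have H0: "0 \<le> H \<omega>" for \<omega> using c \<rho> by (simp add: H_def)
  have bound: "\<epsilon> \<omega> \<bullet> (\<zeta> - \<theta>) / a - L / (8 * a) * (norm (\<zeta> - \<theta>))\<^sup>2 - c * pen + c \<le> H \<omega>"
    if \<zeta>: "\<zeta> \<in> V" for \<omega> \<zeta>
  proof -
    have "\<epsilon> \<omega> \<bullet> (\<zeta> - \<theta>) / a - L / (8 * a) * (norm (\<zeta> - \<theta>))\<^sup>2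
        = (\<epsilon> \<omega> \<bullet> (\<zeta> - \<theta>) - L / 8 * (norm (\<zeta> - \<theta>))\<^sup>2) / a"
      using a by (simp add: field_simps)
    also have "\<dots> \<le> T \<omega>"
      unfolding T_def Q_def using a by (intro divide_right_mono proj[OF \<zeta>]) auto
    finally have 1: "\<epsilon> \<omega> \<bullet> (\<zeta> - \<theta>) / a - L / (8 * a) * (norm (\<zeta> - \<theta>))\<^sup>2 \<le> T \<omega>" .
    \<comment> \<open>The added 1 is the surplus \<open>2 * (U / L)\<close> in units of
      \<open>c\<close>. It contributes \<open>\<rho> < 1\<close> to the exponent, which the
      \<open>- 1\<close> in the next inequality absorbs.\<close>
    let ?x = "T \<omega> / c - pen + 1"
    have "\<rho> * ?x \<le> exp (\<rho> * ?x - 1)"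
      using exp_ge_add_one_self[of "\<rho> * ?x - 1"] by simp
    also have "\<dots> \<le> exp (\<rho> * (T \<omega> / c - pen))"
      using \<rho> by (simp add: algebra_simps)
    finally have "c / \<rho> * (\<rho> * ?x) \<le> H \<omega>"
      unfolding H_def using c \<rho> by (intro mult_left_mono) auto
    then have "T \<omega> - c * pen + c \<le> H \<omega>"
      using c \<rho> by (simp add: algebra_simps)
    then show ?thesis using 1 by linarith
  qed
  define \<mu> where "\<mu> = \<rho> / (a * U)"
  have \<mu>: "\<mu> \<ge> 0" "\<mu> * (a * U) = \<rho>" using \<rho> a U by (auto simp: \<mu>_def)
  define w where "w = (- (\<rho> * L / (2 * a * U))) *\<^sub>R \<theta>'"
  define d where "d = \<rho> * L\<^sup>2 / (16 * a * U) * (\<theta>' \<bullet> \<theta>')"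
  have T_eq: "\<rho> * (T \<omega> / c - pen) = (\<mu> * Q \<omega> + w \<bullet> \<epsilon> \<omega>) + (- d - \<rho> * pen)" for \<omega>
  proof -
    have "T \<omega> / c = L / (2 * a * U) * (2 / L * Q \<omega> - \<epsilon> \<omega> \<bullet> \<theta>' - L / 8 * (\<theta>' \<bullet> \<theta>'))"
      using L by (simp add: T_def c_def mult_ac)
    also have "\<dots> = Q \<omega> / (a * U) - L / (2 * a * U) * (\<epsilon> \<omega> \<bullet> \<theta>') - L\<^sup>2 / (16 * a * U) * (\<theta>' \<bullet> \<theta>')"
      unfolding right_diff_distrib using L by (simp add: power2_eq_square)
    finally show ?thesis
      by (simp add: \<mu>_def w_def d_def inner_commute[of \<theta>' "\<epsilon> \<omega>"] right_diff_distrib)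
  qed
  \<comment> \<open>The tilt along \<open>\<theta>'\<close> costs \<open>2 * \<rho> * d\<close>,
    while the negative quadratic in \<open>\<theta>'\<close> supplies \<open>d\<close>; here
    \<open>2 * \<rho> < 1\<close> matters.\<close>
  have ww: "a * U * (w \<bullet> w) / 2 \<le> d"
  proof -
    have "a * U * (w \<bullet> w) / 2 = 2 * \<rho> * d"
      using a U by (simp add: w_def d_def power2_eq_square mult_ac)
    also have "\<dots> \<le> 1 * d"
      using \<rho> a U by (intro mult_right_mono) (auto simp: d_def)
    finally show ?thesis by simp
  qed
  have root: "(1 / sqrt (1 - 2 * \<rho>)) ^ card B \<le> exp (real k * (\<rho> * (1 + m)))"
  proof -
    have q: "1 / sqrt (1 - 2 * \<rho>) = sqrt (1 + 2 * m)"
      unfolding \<rho>(3) using m by (simp add: real_sqrt_divide)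
    have "sqrt (1 + 2 * m) = exp (ln (1 + 2 * m) / 2)"
      using m by (simp add: ln_sqrt[symmetric])
    also have "ln (1 + 2 * m) / 2 \<le> \<rho> * (1 + m)"
    proof -
      have "ln (1 + 2 * m) \<le> ((1 + 2 * m) - 1 / (1 + 2 * m)) / 2"
        using m by (intro ln_le_half_diff_inverse) auto
      also have "\<dots> = 2 * (\<rho> * (1 + m))"
        using m by (simp add: \<rho>_def field_simps)
      finally show ?thesis by simp
    qed
    finally have "sqrt (1 + 2 * m) \<le> exp (\<rho> * (1 + m))" by simp
    then have "sqrt (1 + 2 * m) ^ k \<le> exp (\<rho> * (1 + m)) ^ k"
      using m by (intro power_mono) auto
    moreover have "sqrt (1 + 2 * m) ^ card B \<le> sqrt (1 + 2 * m) ^ k"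
      using m V(2) B(4) by (intro power_increasing) auto
    ultimately show ?thesis unfolding q by (simp add: exp_of_nat_mult)
  qed
  \<comment> \<open>Since \<open>1 + m = A + s\<close>, the summand \<open>A\<close> of the penalty
    cancels. \<open>s \<le> m\<close> amounts to \<open>s \<le> \<rho> * (1 + 2 * s)\<close>;
    multiplying by \<open>s\<close> brings in \<open>s\<^sup>2 = 2 * l\<close>. Half of the
    resulting decay is kept.\<close>
  have expo: "real k * (\<rho> * (1 + m)) - \<rho> * pen \<le> - real k * l"
  proof -
    have "s * (1 + 2 * m) \<le> m * (1 + 2 * s)" using m by (simp add: algebra_simps)
    then have "s \<le> \<rho> * (1 + 2 * s)" using m by (simp add: \<rho>_def field_simps)
    then have "s * s \<le> s * (\<rho> * (1 + 2 * s))" using s by (intro mult_left_mono) auto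
    also have "s * (\<rho> * (1 + 2 * s)) = \<rho> * (s + 2 * (s * s))" by (simp add: algebra_simps)
    finally have "2 * l \<le> \<rho> * (s + 4 * l)" using s(2) by (simp add: power2_eq_square)
    then have "real k * (2 * l) \<le> real k * (\<rho> * (s + 4 * l))" by (intro mult_left_mono) auto
    moreover have "real k * (\<rho> * (1 + m)) - \<rho> * pen = - (real k * (\<rho> * (s + 4 * l)))"
      by (simp add: pen_def m_def algebra_simps)
    moreover have "0 \<le> real k * l" using l by simp
    ultimately show ?thesis by simp
  qed
  have nn: "(\<integral>\<^sup>+\<omega>. ennreal (H \<omega>) \<partial>P) \<le> ennreal (c / \<rho> * exp (- real k * l))"
  proof -
    have "(\<integral>\<^sup>+\<omega>. ennreal (H \<omega>) \<partial>P)
        = (\<integral>\<^sup>+\<omega>. ennreal (c / \<rho> * exp (- d - \<rho> * pen)) * ennreal (exp (\<mu> * Q \<omega> + w \<bullet> \<epsilon> \<omega>)) \<partial>P)"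
      using c \<rho> unfolding H_def T_eq exp_add
      by (intro nn_integral_cong) (simp add: ennreal_mult[symmetric] mult_ac)
    also have "\<dots> = ennreal (c / \<rho> * exp (- d - \<rho> * pen)) * (\<integral>\<^sup>+\<omega>. ennreal (exp (\<mu> * Q \<omega> + w \<bullet> \<epsilon> \<omega>)) \<partial>P)"
      by (rule nn_integral_cmult) (simp add: Q_def)
    also have "\<dots> \<le> ennreal (c / \<rho> * exp (- d - \<rho> * pen))
         * ennreal ((1 / sqrt (1 - 2 * (\<mu> * (a * U)))) ^ card B * exp (a * U * (w \<bullet> w) / 2))"
      unfolding Q_def using \<rho> \<mu> B perp finB
      by (intro mult_left_mono subgaussian_quadratic_mgf[OF sg sigma_finite_measure_axioms])
        (auto simp: w_def)
    also have "\<dots> = ennreal (c / \<rho> * exp (- d - \<rho> * pen)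
         * ((1 / sqrt (1 - 2 * \<rho>)) ^ card B * exp (a * U * (w \<bullet> w) / 2)))"
      unfolding \<mu>(2) using c \<rho>(1,2) by (intro ennreal_mult[symmetric]) auto
    also have "\<dots> \<le> ennreal (c / \<rho> * exp (- d - \<rho> * pen) * (exp (real k * (\<rho> * (1 + m))) * exp d))"
      using c \<rho> ww by (intro ennreal_leI mult_left_mono mult_mono root) auto
    also have "c / \<rho> * exp (- d - \<rho> * pen) * (exp (real k * (\<rho> * (1 + m))) * exp d)
        = c / \<rho> * exp (real k * (\<rho> * (1 + m)) - \<rho> * pen)"
      by (simp add: mult_exp_exp algebra_simps)
    also have "ennreal \<dots> \<le> ennreal (c / \<rho> * exp (- real k * l))"
      using c \<rho> expo by (intro ennreal_leI mult_left_mono) auto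
    finally show ?thesis .
  qed
  have int: "integrable P H"
    using nn H0 by (intro integrableI_nonneg) (auto intro: le_less_trans)
  have "(\<integral>\<omega>. H \<omega> \<partial>P) \<le> c / \<rho> * exp (- real k * l)"
    using nn c \<rho> H0 by (simp add: nn_integral_eq_integral[OF int])
  also have "c / \<rho> \<le> c * ((2 * A - 1) / (A - 1))"
  proof -
    have "1 / \<rho> = 2 + 1 / m" using m by (simp add: \<rho>_def field_simps)
    also have "\<dots> \<le> 2 + 1 / (A - 1)" using m A by (simp add: frac_le)
    also have "\<dots> = (2 * A - 1) / (A - 1)" using A by (simp add: field_simps)
    finally have "c * (1 / \<rho>) \<le> c * ((2 * A - 1) / (A - 1))" using c by (intro mult_left_mono) auto
    then show ?thesis by simp
  qed
  finally have le: "(\<integral>\<omega>. H \<omega> \<partial>P) \<le> c * ((2 * A - 1) / (A - 1)) * exp (- real k * l)"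
    by (simp add: mult_right_mono)
  show thesis
    using that[OF int H0] bound le by (simp add: c_def pen_def s_def mult.assoc)
qed

lemma matrix_vector_mult_in_span_columns:
  fixes X :: "real^'p^'n"
  assumes "\<And>j. j \<notin> M \<Longrightarrow> \<beta> $ j = 0"
  shows "X *v \<beta> \<in> span ((\<lambda>j. column j X) ` M)"
proof -
  have "X *v \<beta> = (\<Sum>j\<in>UNIV. \<beta> $ j *\<^sub>R column j X)"
    by (simp add: matrix_mult_sum scalar_mult_eq_scaleR)
  also have "\<dots> = (\<Sum>j\<in>M. \<beta> $ j *\<^sub>R column j X)"
    using assms by (intro sum.mono_neutral_right) auto
  also have "\<dots> \<in> span ((\<lambda>j. column j X) ` M)"
    by (intro span_sum span_scale span_base) auto
  finally show ?thesis .
qed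

lemma sum_by_card:
  fixes g :: "nat \<Rightarrow> real"
  shows "(\<Sum>M\<in>{M::'p::finite set. 1 \<le> card M \<and> card M < r}. g (card M))
       = (\<Sum>k = 1..r - 1. real (CARD('p) choose k) * g k)"
proof -
  let ?S = "{M::'p set. 1 \<le> card M \<and> card M < r}"
  have "(\<Sum>M\<in>?S. g (card M)) = (\<Sum>k = 1..r - 1. \<Sum>M\<in>{M\<in>?S. card M = k}. g (card M))"
    by (rule sum.group[symmetric]) auto
  also have "\<dots> = (\<Sum>k = 1..r - 1. real (CARD('p) choose k) * g k)"
  proof (rule sum.cong[OF refl])
    fix k assume "k \<in> {1..r - 1}"
    then have "{M\<in>?S. card M = k} = {M. M \<subseteq> UNIV \<and> card M = k}" by auto
    moreover have "card {M. M \<subseteq> (UNIV::'p set) \<and> card M = k} = CARD('p) choose k"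
      by (rule n_subsets) simp
    ultimately show "(\<Sum>M\<in>{M\<in>?S. card M = k}. g (card M)) = real (CARD('p) choose k) * g k"
      by simp
  qed
  finally show ?thesis .
qed

text \<open>A union bound in expectation: a sum of nonnegative majorants dominates each of them, so
  one \<open>G\<close> serves every model and coefficient vector, hence also a data-driven
  choice.\<close>

lemma nonempty_models_excess_bound:
  fixes \<epsilon> :: "'w \<Rightarrow> real^'n" and X :: "real^'p^'n"
  assumes sg: "subgaussian P (a * U) \<epsilon>" and prob: "prob_space P"
    and a: "a > 0" and L: "0 < L" "L \<le> U" and A: "A > 1"
    and rankX: "rank X = r"
    and Lw_pos: "\<And>k. 1 \<le> k \<Longrightarrow> k \<le> r \<Longrightarrow> Lw k > 0"
    and Lw_sum: "(\<Sum>k = 1..r - 1. real (CARD('p) choose k) * exp (- real k * Lw k))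
                   + exp (- real r * Lw r) \<le> S"
  obtains G where "integrable P G" and "\<And>\<omega>. 0 \<le> G \<omega>"
    and "\<And>\<omega> M \<beta>. M \<in> models r \<Longrightarrow> M \<noteq> {} \<Longrightarrow> (\<And>j. j \<notin> M \<Longrightarrow> \<beta> $ j = 0) \<Longrightarrow>
           \<epsilon> \<omega> \<bullet> (X *v \<beta> - \<theta>) / a - L / (8 * a) * (norm (X *v \<beta> - \<theta>))\<^sup>2
           - 2 * (U / L) * real (card M) * (A + 2 * sqrt (2 * Lw (card M)) + 4 * Lw (card M))
           + 2 * (U / L) \<le> G \<omega>"
    and "(\<integral>\<omega>. G \<omega> \<partial>P) \<le> 2 * (U / L) * ((2 * A - 1) / (A - 1)) * S"
\<comment> \<open>For rank 0 no nonempty model is admissible, and \<open>Lw_sum\<close> reduces to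
  \<open>1 \<le> S\<close>.\<close>
proof (cases "r = 0")
  case True
  have "S \<ge> 0" using Lw_sum True by simp
  then show thesis
    using True L A by (intro that[of "\<lambda>_. 0"]) (auto simp: models_def)
next
  case False
  define C where "C = 2 * (U / L) * ((2 * A - 1) / (A - 1))"
  have C: "C \<ge> 0" using L A by (simp add: C_def)
  define good where "good = (\<lambda>V k H. integrable P H \<and> (\<forall>\<omega>. 0 \<le> H \<omega>) \<and>
     (\<forall>\<omega> \<zeta>. \<zeta> \<in> V \<longrightarrow> \<epsilon> \<omega> \<bullet> (\<zeta> - \<theta>) / a - L / (8 * a) * (norm (\<zeta> - \<theta>))\<^sup>2
           - 2 * (U / L) * real k * (A + 2 * sqrt (2 * Lw k) + 4 * Lw k) + 2 * (U / L) \<le> H \<omega>) \<and>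
     (\<integral>\<omega>. H \<omega> \<partial>P) \<le> C * exp (- real k * Lw k))"
  have ex: "\<exists>H. good V k H" if "subspace V" "dim V \<le> k" "1 \<le> k" "k \<le> r" for V k
    using subspace_excess_bound[OF sg prob a L A Lw_pos[OF that(3,4)] that(1,2), of \<theta>]
    unfolding good_def C_def by metis
  let ?V = "\<lambda>M. span ((\<lambda>j. column j X) ` M)"
  let ?S = "{M::'p set. 1 \<le> card M \<and> card M < r}"
  have "\<exists>H. good (?V M) (card M) H" if "M \<in> ?S" for M
  proof (rule ex)
    have "dim (?V M) \<le> card ((\<lambda>j. column j X) ` M)"
      by (simp add: dim_le_card')
    also have "\<dots> \<le> card M" by (simp add: card_image_le)
    finally show "dim (?V M) \<le> card M" .
  qed (use that in auto)
  then obtain H where H: "\<And>M. M \<in> ?S \<Longrightarrow> good (?V M) (card M) (H M)" by metis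
  text \<open>All models of maximal size share the column space of \<open>X\<close>, so they cost a single term.\<close>
  have "subspace (range ((*v) X))"
    by (intro linear_subspace_image matrix_vector_mul_linear subspace_UNIV)
  then obtain H0 where H0: "good (range ((*v) X)) r H0"
    using ex[of "range ((*v) X)" r] False rankX by (auto simp: rank_dim_range)
  define G where "G = (\<lambda>\<omega>. (\<Sum>M\<in>?S. H M \<omega>) + H0 \<omega>)"
  have H_nonneg: "0 \<le> H M \<omega>" if "M \<in> ?S" for M \<omega> using H[OF that] by (simp add: good_def)
  have H0_nonneg: "0 \<le> H0 \<omega>" for \<omega> using H0 by (simp add: good_def)
  show thesis
  proof (rule that[of G])
    have int: "integrable P (\<lambda>\<omega>. \<Sum>M\<in>?S. H M \<omega>)" "integrable P H0"
      "\<And>M. M \<in> ?S \<Longrightarrow> integrable P (H M)"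
      using H H0 by (auto simp: good_def)
    show "integrable P G" unfolding G_def using int by simp
    show "0 \<le> G \<omega>" for \<omega>
      unfolding G_def using H_nonneg H0_nonneg by (intro add_nonneg_nonneg sum_nonneg) auto
    have "(\<integral>\<omega>. G \<omega> \<partial>P) = (\<Sum>M\<in>?S. \<integral>\<omega>. H M \<omega> \<partial>P) + (\<integral>\<omega>. H0 \<omega> \<partial>P)"
      unfolding G_def using int by (simp add: Bochner_Integration.integral_sum)
    also have "\<dots> \<le> (\<Sum>M\<in>?S. C * exp (- real (card M) * Lw (card M))) + C * exp (- real r * Lw r)"
      using H H0 by (intro add_mono sum_mono) (auto simp: good_def)
    also have "\<dots> = C * ((\<Sum>k = 1..r - 1. real (CARD('p) choose k) * exp (- real k * Lw k)) + exp (- real r * Lw r))"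
      unfolding sum_by_card[where g = "\<lambda>k. exp (- real k * Lw k)", symmetric]
      by (simp add: sum_distrib_left distrib_left)
    also have "\<dots> \<le> C * S" using Lw_sum C by (rule mult_left_mono)
    finally show "(\<integral>\<omega>. G \<omega> \<partial>P) \<le> 2 * (U / L) * ((2 * A - 1) / (A - 1)) * S"
      by (simp add: C_def)
    fix \<omega> M and \<beta> :: "real^'p"
    assume M: "M \<in> models r" "M \<noteq> {}" and \<beta>: "\<And>j. j \<notin> M \<Longrightarrow> \<beta> $ j = 0"
    let ?lhs = "\<epsilon> \<omega> \<bullet> (X *v \<beta> - \<theta>) / a - L / (8 * a) * (norm (X *v \<beta> - \<theta>))\<^sup>2
           - 2 * (U / L) * real (card M) * (A + 2 * sqrt (2 * Lw (card M)) + 4 * Lw (card M)) + 2 * (U / L)"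
    have "card M \<ge> 1" using M(2) by (simp add: Suc_leI card_gt_0_iff)
    show "?lhs \<le> G \<omega>"
    proof (cases "card M = r")
      case True
      then have "?lhs \<le> H0 \<omega>" using H0 unfolding good_def by auto
      also have "\<dots> \<le> G \<omega>"
        unfolding G_def using sum_nonneg[of ?S "\<lambda>M. H M \<omega>"] H_nonneg by simp
      finally show ?thesis .
    next
      case False
      then have MS: "M \<in> ?S" using M(1) \<open>card M \<ge> 1\<close> by (auto simp: models_def)
      have "X *v \<beta> \<in> ?V M" using \<beta> by (rule matrix_vector_mult_in_span_columns)
      then have "?lhs \<le> H M \<omega>" using H[OF MS] unfolding good_def by blast
      also have "\<dots> \<le> (\<Sum>M\<in>?S. H M \<omega>)"
        using MS H_nonneg by (intro member_le_sum) auto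
      also have "\<dots> \<le> G \<omega>" unfolding G_def using H0_nonneg[of \<omega>] by simp
      finally show ?thesis .
    qed
  qed
qed

section \<open>The oracle inequality\<close>

theorem theorem1:
  fixes P :: "'w measure" and \<nu> :: "real measure"
    and Y :: "'w \<Rightarrow> real^'n"
    and \<theta> :: "real^'n"
    and X :: "real^'p^'n"
    and \<Theta> :: "real set"
    and a \<LL> \<UU> A S :: real
    and b b1 b2 :: "real \<Rightarrow> real"
    and c :: "real \<Rightarrow> real \<Rightarrow> real"
    and r :: nat
    and Lw :: "nat \<Rightarrow> real"
    and Pen :: "nat \<Rightarrow> real"
    and betahat :: "'p set \<Rightarrow> real^'n \<Rightarrow> real^'p"
    and Mhat :: "real^'n \<Rightarrow> 'p set"
  assumes Theta_closed: "closed \<Theta>" and Theta_interval: "is_interval \<Theta>"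
    and b1: "\<And>t. (b has_real_derivative b1 t) (at t)"
    and b2: "\<And>t. (b1 has_real_derivative b2 t) (at t)"
    and LU: "0 < \<LL>" "\<LL> \<le> \<UU>"
    and b2_upper: "\<And>t. b2 t \<le> \<UU>"
    and b2_lower: "\<And>t. t \<in> \<Theta> \<Longrightarrow> b2 t \<ge> \<LL>"
    and a_pos: "a > 0"
    and prob: "prob_space P"
    and nu_sets: "sets \<nu> = sets borel"
    and normalized: "\<And>eta. (\<integral>\<^sup>+ y. ennreal (expfam_dens a b c eta y) \<partial>\<nu>) = 1"
    and theta_in: "\<And>i. \<theta> $ i \<in> \<Theta>"
    and indep: "prob_space.indep_vars P (\<lambda>_. borel) (\<lambda>i \<omega>. Y \<omega> $ i) UNIV"
    and distr: "\<And>i. distributed P \<nu> (\<lambda>\<omega>. Y \<omega> $ i) (\<lambda>y. ennreal (expfam_dens a b c (\<theta> $ i) y))"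
    and rankX: "rank X = r"
    and cols_indep: "\<And>M. card M = r \<Longrightarrow>
           inj_on (\<lambda>j. column j X) M \<and> independent ((\<lambda>j. column j X) ` M)"
    and Lw_pos: "\<And>k. 1 \<le> k \<Longrightarrow> k \<le> r \<Longrightarrow> Lw k > 0"
    and Lw_sum: "(\<Sum>k = 1..r - 1. real (CARD('p) choose k) * exp (- real k * Lw k))
                   + exp (- real r * Lw r) \<le> S"
    and A_gt: "A > 1"
    and Pen_nonneg: "\<And>k. Pen k \<ge> 0"
    and Pen_lower: "\<And>k. 1 \<le> k \<Longrightarrow> k \<le> r \<Longrightarrow>
           Pen k \<ge> 2 * (\<UU> / \<LL>) * real k * (A + 2 * sqrt (2 * Lw k) + 4 * Lw k)"
    and betahat_mem: "\<And>M y. M \<in> models r \<Longrightarrow> betahat M y \<in> Bset X \<Theta> M"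
    and betahat_max: "\<And>M y beta. M \<in> models r \<Longrightarrow> beta \<in> Bset X \<Theta> M \<Longrightarrow>
           loglik b X y beta \<le> loglik b X y (betahat M y)"
    and Mhat_mem: "\<And>y. Mhat y \<in> models r"
    and Mhat_min: "\<And>y M. M \<in> models r \<Longrightarrow>
           (1 / a) * (- loglik b X y (betahat (Mhat y) y)) + Pen (card (Mhat y))
             \<le> (1 / a) * (- loglik b X y (betahat M y)) + Pen (card M)"
  shows "(\<integral>\<^sup>+ \<omega>. ennreal (KL a b b1 \<theta> (X *v betahat (Mhat (Y \<omega>)) (Y \<omega>))) \<partial>P)
           \<le> ennreal (4 / 3 * (INF M \<in> models r.
                              (INF beta \<in> Bset X \<Theta> M. KL a b b1 \<theta> (X *v beta)) + Pen (card M))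
                     + 16 / 3 * (\<UU> / \<LL>) * ((2 * A - 1) / (A - 1)) * S)"


proof -
  interpret prob_space P by fact
  define \<epsilon> where "\<epsilon> = (\<lambda>\<omega>. Y \<omega> - (\<chi> i. b1 (\<theta> $ i)))"
  have sg: "subgaussian P (a * \<UU>) \<epsilon>"
    unfolding \<epsilon>_def using expfam_subgaussian[OF b1 b2 b2_upper a_pos prob nu_sets normalized indep distr] .
  have U: "\<UU> > 0" using LU by simp
  have KL_ge: "\<LL> / (2 * a) * (norm (X *v \<beta> - \<theta>))\<^sup>2 \<le> KL a b b1 \<theta> (X *v \<beta>)"
    if "\<beta> \<in> Bset X \<Theta> M" for \<beta> M
    using that by (intro KL_ge_norm_square[OF Theta_interval b1 b2 b2_lower a_pos theta_in]) (auto simp: Bset_def)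
  have KL_nonneg: "0 \<le> KL a b b1 \<theta> (X *v \<beta>)" if "\<beta> \<in> Bset X \<Theta> M" for \<beta> M
    using LU a_pos by (intro order.trans[OF _ KL_ge[OF that]]) simp
  define f where "f = (\<lambda>\<omega>. KL a b b1 \<theta> (X *v betahat (Mhat (Y \<omega>)) (Y \<omega>)))"
  define C where "C = 2 * (\<UU> / \<LL>) * ((2 * A - 1) / (A - 1))"
  have C: "C \<ge> 0" using LU A_gt by (simp add: C_def)
  have S: "S \<ge> 0"
    by (rule order.trans[OF _ Lw_sum]) (auto intro!: add_nonneg_nonneg sum_nonneg)
  obtain G where G: "integrable P G" "\<And>\<omega>. 0 \<le> G \<omega>"
    "\<And>\<omega> M \<beta>. M \<in> models r \<Longrightarrow> M \<noteq> {} \<Longrightarrow> (\<And>j. j \<notin> M \<Longrightarrow> \<beta> $ j = 0) \<Longrightarrow>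
           \<epsilon> \<omega> \<bullet> (X *v \<beta> - \<theta>) / a - \<LL> / (8 * a) * (norm (X *v \<beta> - \<theta>))\<^sup>2
           - 2 * (\<UU> / \<LL>) * real (card M) * (A + 2 * sqrt (2 * Lw (card M)) + 4 * Lw (card M))
           + 2 * (\<UU> / \<LL>) \<le> G \<omega>"
    "(\<integral>\<omega>. G \<omega> \<partial>P) \<le> C * S"
    using nonempty_models_excess_bound[OF sg prob a_pos LU A_gt rankX Lw_pos Lw_sum, of \<theta>]
    unfolding C_def by blast
  \<comment> \<open>The fit of the empty model is 0, so its noise term is \<open>- e\<close>;
    \<open>v\<close> bounds the variance of \<open>e\<close>. \<open>\<kappa>\<close> makes
    \<open>\<kappa> * v\<close> the quadratic term of that model and
    \<open>1 / (4 * \<kappa>)\<close> the surplus \<open>2 * (\<UU> / \<LL>)\<close>.\<close>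
  define e where "e = (\<lambda>\<omega>. ((1 / a) *\<^sub>R \<theta>) \<bullet> \<epsilon> \<omega>)"
  define v where "v = \<UU> / a * (\<theta> \<bullet> \<theta>)"
  define \<kappa> where "\<kappa> = \<LL> / (8 * \<UU>)"
  define \<alpha> where "\<alpha> = 1 / (1 + 4 * \<kappa>\<^sup>2 * v)"
  define \<delta> where "\<delta> = \<kappa> / (1 + 4 * \<kappa>\<^sup>2 * v)"
  have v: "v \<ge> 0" using U a_pos by (simp add: v_def)
  have \<kappa>: "\<kappa> > 0" using U LU by (simp add: \<kappa>_def)
  have \<delta>: "\<delta> \<ge> 0" using \<kappa> v by (simp add: \<delta>_def)
  have par: "- e \<omega> - \<LL> / (8 * a) * (\<theta> \<bullet> \<theta>) \<le> - \<alpha> * e \<omega> + \<delta> * ((e \<omega>)\<^sup>2 - v)"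
    "- (2 * (\<UU> / \<LL>)) \<le> - \<alpha> * e \<omega> + \<delta> * ((e \<omega>)\<^sup>2 - v)" for \<omega>
  proof -
    have "\<kappa> * v = \<LL> / (8 * a) * (\<theta> \<bullet> \<theta>)" "- 1 / (4 * \<kappa>) = - (2 * (\<UU> / \<LL>))"
      using U LU by (auto simp: \<kappa>_def v_def)
    then show "- e \<omega> - \<LL> / (8 * a) * (\<theta> \<bullet> \<theta>) \<le> - \<alpha> * e \<omega> + \<delta> * ((e \<omega>)\<^sup>2 - v)"
      "- (2 * (\<UU> / \<LL>)) \<le> - \<alpha> * e \<omega> + \<delta> * ((e \<omega>)\<^sup>2 - v)"
      using parabola_dominates_max[OF \<kappa> v, of "e \<omega>"] by (auto simp: \<alpha>_def \<delta>_def)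
  qed
  have e: "integrable P e" "(\<integral>\<omega>. e \<omega> \<partial>P) = 0" "integrable P (\<lambda>\<omega>. (e \<omega>)\<^sup>2)"
    unfolding e_def by (rule subgaussian_linear[OF sg prob])+
  have e2: "(\<integral>\<omega>. (e \<omega>)\<^sup>2 \<partial>P) \<le> v"
  proof -
    have "(\<integral>\<omega>. (e \<omega>)\<^sup>2 \<partial>P) \<le> a * \<UU> * (((1 / a) *\<^sub>R \<theta>) \<bullet> ((1 / a) *\<^sub>R \<theta>))"
      unfolding e_def by (rule subgaussian_linear(4)[OF sg prob])
    also have "\<dots> = v" using a_pos by (simp add: v_def)
    finally show ?thesis .
  qed

  \<comment> \<open>One competitor at a time: \<open>\<beta>\<close> does not depend on the data, so
    \<open>e0\<close> below is centred. The infima are taken at the end.\<close>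
  have main: "(\<integral>\<^sup>+ \<omega>. ennreal (f \<omega>) \<partial>P) \<le> ennreal (4 / 3 * (KL a b b1 \<theta> (X *v \<beta>) + Pen (card M) + C * S))"
    if M: "M \<in> models r" and \<beta>: "\<beta> \<in> Bset X \<Theta> M" for M \<beta>
  proof -
    define R where "R = KL a b b1 \<theta> (X *v \<beta>) + Pen (card M)"
    define e0 where "e0 = (\<lambda>\<omega>. ((1 / a) *\<^sub>R (\<theta> - X *v \<beta>)) \<bullet> \<epsilon> \<omega>)"
    have e0: "integrable P e0" "(\<integral>\<omega>. e0 \<omega> \<partial>P) = 0"
      unfolding e0_def by (rule subgaussian_linear[OF sg prob])+
    define h where "h = (\<lambda>\<omega>. 4 / 3 * (R + e0 \<omega> + (- \<alpha> * e \<omega> + \<delta> * ((e \<omega>)\<^sup>2 - v)) + G \<omega>))"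
    have fh: "0 \<le> f \<omega> \<and> f \<omega> \<le> h \<omega>" for \<omega>
    proof -
      define y where "y = Y \<omega>"
      define M' where "M' = Mhat y"
      define \<gamma> where "\<gamma> = betahat M' y"
      have M': "M' \<in> models r" unfolding M'_def by (rule Mhat_mem)
      have \<gamma>: "\<gamma> \<in> Bset X \<Theta> M'" unfolding \<gamma>_def by (rule betahat_mem[OF M'])
      have f: "f \<omega> = KL a b b1 \<theta> (X *v \<gamma>)" by (simp add: f_def \<gamma>_def M'_def y_def)
      \<comment> \<open>Two optimality properties are chained: the estimator of \<open>M\<close>
        against \<open>\<beta>\<close>, then the selected model against \<open>M\<close>.\<close>
      have "(1 / a) * loglik b X y \<beta> \<le> (1 / a) * loglik b X y (betahat M y)"
        using a_pos betahat_max[OF M \<beta>, of y] by (intro mult_left_mono) auto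
      moreover have "(1 / a) * (- loglik b X y \<gamma>) + Pen (card M')
          \<le> (1 / a) * (- loglik b X y (betahat M y)) + Pen (card M)"
        unfolding \<gamma>_def M'_def by (rule Mhat_min[OF M])
      ultimately have pen: "(1 / a) * (loglik b X y \<beta> - loglik b X y \<gamma>) \<le> Pen (card M) - Pen (card M')"
        by (simp add: algebra_simps)
      have "f \<omega> - KL a b b1 \<theta> (X *v \<beta>)
          = (1 / a) * (loglik b X y \<beta> - loglik b X y \<gamma>) + (1 / a) * (\<epsilon> \<omega> \<bullet> (X *v \<gamma> - X *v \<beta>))"
        unfolding f KL_diff_eq_loglik_diff[where y = y] by (simp add: \<epsilon>_def y_def distrib_left)
      moreover have "(1 / a) * (\<epsilon> \<omega> \<bullet> (X *v \<gamma> - X *v \<beta>)) = \<epsilon> \<omega> \<bullet> (X *v \<gamma> - \<theta>) / a + e0 \<omega>"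
        by (simp add: e0_def inner_diff_left inner_diff_right inner_commute[of \<theta> "\<epsilon> \<omega>"] inner_commute[of "X *v \<beta>" "\<epsilon> \<omega>"] diff_divide_distrib)
      ultimately have basic: "f \<omega> + Pen (card M') \<le> R + e0 \<omega> + \<epsilon> \<omega> \<bullet> (X *v \<gamma> - \<theta>) / a"
        using pen unfolding R_def by linarith
      \<comment> \<open>\<open>\<LL> / (8 * a)\<close> is a quarter of the constant in
        \<open>KL_ge\<close>; the \<open>3 / 4\<close> of the loss left over is the source of the
        factor \<open>4 / 3\<close>.\<close>
      have quarter: "\<LL> / (8 * a) * (norm (X *v \<gamma> - \<theta>))\<^sup>2 \<le> f \<omega> / 4"
        using KL_ge[OF \<gamma>] unfolding f by (simp add: field_simps)
      have "\<epsilon> \<omega> \<bullet> (X *v \<gamma> - \<theta>) / a - \<LL> / (8 * a) * (norm (X *v \<gamma> - \<theta>))\<^sup>2 - Pen (card M')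
          \<le> (- \<alpha> * e \<omega> + \<delta> * ((e \<omega>)\<^sup>2 - v)) + G \<omega>"
      proof (cases "M' = {}")
        case True
        then have "\<gamma> = 0" using \<gamma> by (simp add: Bset_def vec_eq_iff)
        then have "\<epsilon> \<omega> \<bullet> (X *v \<gamma> - \<theta>) / a - \<LL> / (8 * a) * (norm (X *v \<gamma> - \<theta>))\<^sup>2
            = - e \<omega> - \<LL> / (8 * a) * (\<theta> \<bullet> \<theta>)"
          by (simp add: e_def inner_commute[of \<theta> "\<epsilon> \<omega>"] power2_norm_eq_inner)
        then show ?thesis using par(1)[of \<omega>] G(2)[of \<omega>] Pen_nonneg[of "card M'"] by linarith
      next
        case False
        have "1 \<le> card M'" "card M' \<le> r"
          using False M' by (auto simp: models_def Suc_le_eq card_gt_0_iff)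
        note Pen_lower[OF this]
        moreover have "\<epsilon> \<omega> \<bullet> (X *v \<gamma> - \<theta>) / a - \<LL> / (8 * a) * (norm (X *v \<gamma> - \<theta>))\<^sup>2
           - 2 * (\<UU> / \<LL>) * real (card M') * (A + 2 * sqrt (2 * Lw (card M')) + 4 * Lw (card M'))
           + 2 * (\<UU> / \<LL>) \<le> G \<omega>"
          using \<gamma> by (intro G(3)[OF M' False]) (auto simp: Bset_def)
        \<comment> \<open>The parabola may be as low as \<open>- (2 * (\<UU> / \<LL>))\<close>; the
          surplus in the bound by \<open>G\<close> makes up for that.\<close>
        ultimately show ?thesis using par(2)[of \<omega>] by linarith
      qed
      then have "3 / 4 * f \<omega> \<le> R + e0 \<omega> + (- \<alpha> * e \<omega> + \<delta> * ((e \<omega>)\<^sup>2 - v)) + G \<omega>"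
        using basic quarter by linarith
      then have "f \<omega> \<le> h \<omega>" unfolding h_def by simp
      moreover have "0 \<le> f \<omega>" unfolding f by (rule KL_nonneg[OF \<gamma>])
      ultimately show ?thesis by simp
    qed
    have inth: "integrable P h" unfolding h_def using e e0 G(1) by simp
    have "(\<integral>\<^sup>+ \<omega>. ennreal (f \<omega>) \<partial>P) \<le> (\<integral>\<^sup>+ \<omega>. ennreal (h \<omega>) \<partial>P)"
      using fh by (intro nn_integral_mono ennreal_leI) auto
    also have "\<dots> = ennreal (\<integral>\<omega>. h \<omega> \<partial>P)"
      using fh by (intro nn_integral_eq_integral inth AE_I2) (auto intro: order.trans)
    also have "(\<integral>\<omega>. h \<omega> \<partial>P) \<le> 4 / 3 * (R + C * S)"
    proof -
      have "(\<integral>\<omega>. h \<omega> \<partial>P) = 4 / 3 * (R + \<delta> * ((\<integral>\<omega>. (e \<omega>)\<^sup>2 \<partial>P) - v) + (\<integral>\<omega>. G \<omega> \<partial>P))"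
        unfolding h_def using e e0 G(1) by (simp add: prob_space)
      also have "\<dots> \<le> 4 / 3 * (R + 0 + C * S)"
        using \<delta> e2 by (intro mult_left_mono add_mono G(4) mult_nonneg_nonpos) auto
      finally show ?thesis by simp
    qed
    finally show ?thesis unfolding R_def by (simp add: ennreal_leI)
  qed

  have emptyM: "({} :: 'p set) \<in> models r" by (simp add: models_def)
  have B_ne: "Bset X \<Theta> M \<noteq> {}" if "M \<in> models r" for M
    using betahat_mem[OF that] by blast
  obtain \<beta>\<^sub>0 where "\<beta>\<^sub>0 \<in> Bset X \<Theta> {}" using B_ne[OF emptyM] by blast
  \<comment> \<open>A single competitor shows that the expected loss is finite, so it becomes a real
    \<open>I\<close> and the infima are treated by bounding each member from below.\<close>
  then obtain I where I: "(\<integral>\<^sup>+ \<omega>. ennreal (f \<omega>) \<partial>P) = ennreal I" "I \<ge> 0"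
    using main[OF emptyM] by (metis ennreal_cases top.not_eq_extremum ennreal_less_top le_less_trans)
  define Inf0 where "Inf0 = (INF M \<in> models r. (INF beta \<in> Bset X \<Theta> M. KL a b b1 \<theta> (X *v beta)) + Pen (card M))"
  have "3 / 4 * I - C * S \<le> Inf0"
    unfolding Inf0_def
  proof (rule cINF_greatest)
    show "(models r :: 'p set set) \<noteq> {}" using emptyM by blast
    fix M :: "'p set" assume M: "M \<in> models r"
    have "3 / 4 * I - C * S - Pen (card M) \<le> (INF beta \<in> Bset X \<Theta> M. KL a b b1 \<theta> (X *v beta))"
    proof (rule cINF_greatest[OF B_ne[OF M]])
      fix \<beta> assume \<beta>: "\<beta> \<in> Bset X \<Theta> M"
      have "0 \<le> 4 / 3 * (KL a b b1 \<theta> (X *v \<beta>) + Pen (card M) + C * S)"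
        using KL_nonneg[OF \<beta>] Pen_nonneg[of "card M"] C S by simp
      then have "I \<le> 4 / 3 * (KL a b b1 \<theta> (X *v \<beta>) + Pen (card M) + C * S)"
        using main[OF M \<beta>] I by (simp add: ennreal_le_iff)
      then show "3 / 4 * I - C * S - Pen (card M) \<le> KL a b b1 \<theta> (X *v \<beta>)"
        by (simp add: algebra_simps)
    qed
    then show "3 / 4 * I - C * S \<le> (INF beta \<in> Bset X \<Theta> M. KL a b b1 \<theta> (X *v beta)) + Pen (card M)"
      by linarith
  qed
  then have "I \<le> 4 / 3 * Inf0 + 4 / 3 * (C * S)" by (simp add: algebra_simps)
  \<comment> \<open>The argument gives half of the stated remainder, which is relaxed here.\<close>
  also have "4 / 3 * (C * S) \<le> 8 / 3 * (C * S)" using C S by simp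
  also have "8 / 3 * (C * S) = 16 / 3 * (\<UU> / \<LL>) * ((2 * A - 1) / (A - 1)) * S"
    by (simp add: C_def)
  finally have "ennreal I \<le> ennreal (4 / 3 * Inf0 + 16 / 3 * (\<UU> / \<LL>) * ((2 * A - 1) / (A - 1)) * S)"
    by (intro ennreal_leI) simp
  then show ?thesis unfolding I(1)[symmetric] f_def Inf0_def .
qed

end
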